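(* Let $(\Omega_n)$ be a locally $m$-convex sequence of $\mathbb{C}$-proper convex open sets in $\mathbb{C}^d$ converging in the local Hausdorff topology to a $\mathbb{C}$-proper convex open set $\Omega$. Let $\varphi_n:\Delta\to\Omega_n$ be complex geodesics, and suppose there are $R>0$ and real numbers $a_n,b_n\in(-1,1)$ such that for all $n$: (1) $0\in[a_n,b_n]$; (2) $\varphi_n([a_n,b_n])\subset B_R(0)$; (3) $\lim_{n\to\infty}\|\varphi_n(a_n)-\varphi_n(b_n)\|>0$; (4) $\delta_{\Omega_n}(\varphi_n(0))=\max\{\delta_{\Omega_n}(\varphi_n(t)): t\in[a_n,b_n]\}$. Then there is a subsequence $n_k\to\infty$ such that $\varphi_{n_k}$ converges locally uniformly to a complex geodesic $\varphi:\Delta\to\Omega$.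
   Context: $\Delta$ is the unit disk with Kobayashi (Poincaré) distance $d_\Delta$; $d_\Omega$ is the Kobayashi distance. A holomorphic map $\varphi:\Delta\to\Omega$ is a complex geodesic if $d_\Omega(\varphi(p),\varphi(q))=d_\Delta(p,q)$ for all $p,q\in\Delta$. $\delta_\Omega(p)$ is the Euclidean distance from $p$ to $\mathbb{C}^d\setminus\Omega$, and $\delta_\Omega(p;v)=\inf\{\|q-p\|:q\in(p+\mathbb{C}v)\setminus\Omega\}$. $(\Omega_n)$ is a locally $m$-convex sequence if for every $R>0$ there exist $N,C>0$ with $\delta_{\Omega_n}(p;v)\le C\delta_{\Omega_n}(p)^{1/m}$ for all $n>N$, $p\in\Omega_n\cap B_R(0)$, $v\neq0$. $\mathbb{C}$-proper: contains no complex affine line. Local Hausdorff topology: convergence of closures intersected with every ball $\overline{B_R(0)}$ in Hausdorff distance. *)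

theory Defs
  imports "HOL-Analysis.Analysis"
begin

text \<open>Poincare distance on the unit disc (this is the Kobayashi distance of the disc).\<close>
definition poincare_dist :: "complex \<Rightarrow> complex \<Rightarrow> real" where
  "poincare_dist z w = artanh (cmod ((z - w) / (1 - cnj z * w)))"

definition holo_disc :: "(complex \<Rightarrow> complex^'d) \<Rightarrow> (complex^'d) set \<Rightarrow> bool" where
  "holo_disc f \<Omega> \<longleftrightarrow> (\<forall>i. (\<lambda>z. f z $ i) holomorphic_on ball 0 1) \<and> f ` ball 0 1 \<subseteq> \<Omega>"

definition kobayashi_dist :: "(complex^'d) set \<Rightarrow> complex^'d \<Rightarrow> complex^'d \<Rightarrow> real" where
  "kobayashi_dist \<Omega> p q = Inf {(\<Sum>i<n. poincare_dist (a i) (b i)) | n f a b.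
      n \<ge> 1 \<and> (\<forall>i<n. holo_disc (f i) \<Omega> \<and> a i \<in> ball 0 1 \<and> b i \<in> ball 0 1)
      \<and> f 0 (a 0) = p \<and> f (n - 1) (b (n - 1)) = q
      \<and> (\<forall>i. Suc i < n \<longrightarrow> f i (b i) = f (Suc i) (a (Suc i)))}"

definition complex_geodesic :: "(complex^'d) set \<Rightarrow> (complex \<Rightarrow> complex^'d) \<Rightarrow> bool" where
  "complex_geodesic \<Omega> \<phi> \<longleftrightarrow> holo_disc \<phi> \<Omega> \<and>
     (\<forall>p\<in>ball 0 1. \<forall>q\<in>ball 0 1. kobayashi_dist \<Omega> (\<phi> p) (\<phi> q) = poincare_dist p q)"

definition bdist :: "(complex^'d) set \<Rightarrow> complex^'d \<Rightarrow> real" where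
  "bdist \<Omega> p = infdist p (- \<Omega>)"

definition cline :: "complex^'d \<Rightarrow> complex^'d \<Rightarrow> (complex^'d) set" where
  "cline p v = {p + c *s v | c. True}"

definition bdist_dir :: "(complex^'d) set \<Rightarrow> complex^'d \<Rightarrow> complex^'d \<Rightarrow> real" where
  "bdist_dir \<Omega> p v = infdist p (cline p v - \<Omega>)"

definition C_proper :: "(complex^'d) set \<Rightarrow> bool" where
  "C_proper \<Omega> \<longleftrightarrow> \<not> (\<exists>p v. v \<noteq> 0 \<and> cline p v \<subseteq> \<Omega>)"

definition locally_m_convex_seq :: "real \<Rightarrow> (nat \<Rightarrow> (complex^'d) set) \<Rightarrow> bool" where
  "locally_m_convex_seq m \<Omega>s \<longleftrightarrow> (\<forall>R>0. \<exists>N::nat. \<exists>C>0. \<forall>n>N. \<forall>p\<in>\<Omega>s n \<inter> ball 0 R.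
      \<forall>v. v \<noteq> 0 \<longrightarrow> bdist_dir (\<Omega>s n) p v \<le> C * bdist (\<Omega>s n) p powr (1 / m))"

text \<open>Convergence in Hausdorff distance of the compact pieces closure(.) \<inter> cball 0 R, for every R > 0,
  written out via epsilon-neighbourhoods (Hausdorff distance < e in both directions;
  empty vs. nonempty counts as infinite distance).\<close>
definition local_hausdorff_conv :: "(nat \<Rightarrow> (complex^'d) set) \<Rightarrow> (complex^'d) set \<Rightarrow> bool" where
  "local_hausdorff_conv \<Omega>s \<Omega> \<longleftrightarrow> (\<forall>R>0. \<forall>e>0. eventually (\<lambda>n.
      (\<forall>x\<in>closure (\<Omega>s n) \<inter> cball 0 R. \<exists>y\<in>closure \<Omega> \<inter> cball 0 R. dist x y < e) \<and>
      (\<forall>y\<in>closure \<Omega> \<inter> cball 0 R. \<exists>x\<in>closure (\<Omega>s n) \<inter> cball 0 R. dist x y < e)) sequentially)"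

end

theory Submission
  imports Defs "HOL-Complex_Analysis.Great_Picard"
begin

text \<open>For a convex domain every supporting hyperplane gives a complex affine functional into a half-plane, so the
  Schwarz--Pick lemma controls holomorphic discs: a disc moves from \<open>p\<close> in direction \<open>v\<close> by at most a
  multiple of the distance to the boundary in direction \<open>v\<close>, which local \<open>m\<close>-convexity bounds by
  \<open>\<delta>(p)\<close> to the power \<open>1/m\<close>.
  For a geodesic whose \<open>\<delta>\<close> is maximal at the centre, short chains from a fixed ball to the points
  of the geodesic give \<open>\<delta>(\<phi>(t)) \<le> A (1 - |t|)\<^sup>\<beta>\<close>. Since \<open>\<delta>(\<phi>(t)) \<le> \<delta>(\<phi>(0))\<close> as well,
  summing along \<open>t = 1 - 16\<^sup>-\<^sup>k\<close> bounds the length of \<open>\<phi>([a, b])\<close> by a multiple of a positive power of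
  \<open>\<delta>(\<phi>(0))\<close>. As the endpoints stay apart, \<open>\<delta>(\<phi>\<^sub>n(0))\<close> is bounded below. Then the discs are
  locally bounded, Montel's theorem yields a limit disc that stays inside \<open>\<Omega>\<close>, and it is a geodesic because
  a chain of discs in \<open>\<Omega>\<close>, slightly shrunk, lies in \<open>\<Omega>\<^sub>n\<close> for large \<open>n\<close>.\<close>

section \<open>Discs in convex domains\<close>

lemma pseudo_hyperbolic_lt_1:
  assumes "cmod z < 1" "cmod w < 1"
  shows "1 - cnj z * w \<noteq> 0" "cmod ((z - w) / (1 - cnj z * w)) < 1"
proof -
  have "(cmod (1 - cnj z * w))\<^sup>2 - (cmod (z - w))\<^sup>2 = (1 - (cmod z)\<^sup>2) * (1 - (cmod w)\<^sup>2)"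
    unfolding cmod_power2 by (simp add: power2_eq_square algebra_simps)
  moreover have "0 < (1 - (cmod z)\<^sup>2) * (1 - (cmod w)\<^sup>2)"
    using assms by (simp add: abs_square_less_1)
  ultimately have "(cmod (z - w))\<^sup>2 < (cmod (1 - cnj z * w))\<^sup>2"
    by linarith
  then have lt: "cmod (z - w) < cmod (1 - cnj z * w)"
    using power2_less_imp_less norm_ge_zero by blast
  then show ne: "1 - cnj z * w \<noteq> 0"
    by auto
  show "cmod ((z - w) / (1 - cnj z * w)) < 1"
    using lt ne by (simp add: norm_divide)
qed

text \<open>The sharp bound has \<open>h z + cnj (h w)\<close> in the last factor. The sum of moduli
  is weaker but can be estimated from the moduli of two values of a linear functional.\<close>

lemma Schwarz_Pick_right_half_plane:
  assumes holo: "h holomorphic_on ball 0 1" and pos: "\<And>z. cmod z < 1 \<Longrightarrow> 0 < Re (h z)"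
    and z: "cmod z < 1" and w: "cmod w < 1"
  shows "cmod (h z - h w) \<le> cmod ((z - w) / (1 - cnj z * w)) * (cmod (h z) + cmod (h w))"
proof -
  \<comment> \<open>\<open>g\<close> is \<open>h\<close> between two Moebius maps moving \<open>w\<close> and \<open>h w\<close> to 0.\<close>
  define M where "M = (\<lambda>x. (x + w) / (1 + cnj w * x))"
  define g where "g = (\<lambda>x. (h (M x) - h w) / (h (M x) + cnj (h w)))"
  have M_lt: "cmod (M x) < 1" and M_den: "1 + cnj w * x \<noteq> 0" if "cmod x < 1" for x
    using pseudo_hyperbolic_lt_1[of "-w" x] w that
    by (auto simp: M_def norm_divide norm_minus_commute add.commute)
  have M_holo: "M holomorphic_on ball 0 1"
    unfolding M_def using M_den by (intro holomorphic_intros) auto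
  have hM: "(\<lambda>x. h (M x)) holomorphic_on ball 0 1"
    using holomorphic_on_compose_gen[OF M_holo holo] M_lt by (force simp: o_def)
  have den: "h (M x) + cnj (h w) \<noteq> 0" if "cmod x < 1" for x
    using pos[OF M_lt[OF that]] pos[OF w] by (auto simp: complex_eq_iff)
  have g_holo: "g holomorphic_on ball 0 1"
    unfolding g_def using den hM by (intro holomorphic_intros) auto
  have g0: "g 0 = 0"
    by (simp add: g_def M_def)
  have g_lt: "cmod (g x) < 1" if "cmod x < 1" for x
  proof -
    \<comment> \<open>Positive real parts put \<open>h (M x)\<close> closer to \<open>h w\<close>
      than to its mirror image \<open>- cnj (h w)\<close> in the imaginary axis.\<close>
    have "(cmod (h (M x) - h w))\<^sup>2 = (cmod (h (M x) + cnj (h w)))\<^sup>2 - 4 * Re (h (M x)) * Re (h w)"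
      unfolding cmod_power2 by (simp add: power2_eq_square algebra_simps)
    also have "\<dots> < (cmod (h (M x) + cnj (h w)))\<^sup>2"
      using pos[OF M_lt[OF that]] pos[OF w] by simp
    finally have "cmod (h (M x) - h w) < cmod (h (M x) + cnj (h w))"
      using power2_less_imp_less norm_ge_zero by blast
    then show ?thesis
      using den[OF that] by (simp add: g_def norm_divide)
  qed
  define \<zeta> where "\<zeta> = (z - w) / (1 - cnj w * z)"
  have ne: "1 - cnj w * z \<noteq> 0" 
    using pseudo_hyperbolic_lt_1[OF w z] by simp
  have ne': "1 - cnj w * w \<noteq> 0" 
    using pseudo_hyperbolic_lt_1[OF w w] by simp
  have \<zeta>_norm: "cmod \<zeta> = cmod ((z - w) / (1 - cnj z * w))"
  proof -
    have "cnj (1 - cnj w * z) = 1 - cnj z * w"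
      by simp
    then have "cmod (1 - cnj w * z) = cmod (1 - cnj z * w)"
      by (metis complex_mod_cnj)
    then show ?thesis by (simp add: \<zeta>_def norm_divide)
  qed
  have \<zeta>_lt: "cmod \<zeta> < 1"
    using pseudo_hyperbolic_lt_1[OF z w] \<zeta>_norm by simp
  have M\<zeta>: "M \<zeta> = z"
  proof -
    have "\<zeta> + w = z * (1 - cnj w * w) / (1 - cnj w * z)" "1 + cnj w * \<zeta> = (1 - cnj w * w) / (1 - cnj w * z)"
      using ne by (simp_all add: \<zeta>_def field_simps)
    then show ?thesis
      unfolding M_def using ne ne' by simp
  qed
  have "cmod (g \<zeta>) \<le> cmod \<zeta>"
    using Schwarz_Lemma(1)[OF g_holo g0 g_lt \<zeta>_lt] by simp
  then have "cmod (h z - h w) \<le> cmod \<zeta> * cmod (h z + cnj (h w))"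
    using den[OF \<zeta>_lt] by (simp add: g_def M\<zeta> norm_divide field_simps)
  also have "\<dots> \<le> cmod \<zeta> * (cmod (h z) + cmod (h w))"
    by (intro mult_left_mono) (metis complex_mod_cnj norm_triangle_ineq, simp)
  finally show ?thesis
    by (simp add: \<zeta>_norm)
qed

text \<open>The Hermitian form whose real part is the real inner product: it turns separating real hyperplanes into
  complex linear functionals.\<close>

definition cform :: "complex^'d \<Rightarrow> complex^'d \<Rightarrow> complex" where
  "cform u x = (\<Sum>i\<in>UNIV. cnj (u $ i) * x $ i)"

lemma Re_cform: "Re (cform u x) = inner u x"
  by (simp add: cform_def inner_vec_def inner_complex_def)

lemma cform_diff: "cform u (x - y) = cform u x - cform u y"
  by (simp add: cform_def sum_subtractf algebra_simps)

lemma cform_scale: "cform u (c *s x) = c * cform u x"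
  by (simp add: cform_def sum_distrib_left algebra_simps)

lemma norm_complex_vector_scale: "norm (c *s x) = cmod c * norm (x :: complex^'d)"
  by (simp add: norm_vec_def norm_mult L2_set_right_distrib)

text \<open>Multiplying \<open>x\<close> by the unit scalar \<open>c\<close> makes the value of the
  form real and nonnegative and keeps the norm, so the real Cauchy-Schwarz inequality
  applies.\<close>

lemma cmod_cform_le: "cmod (cform u x) \<le> norm u * norm x"
proof (cases "cform u x = 0")
  case False
  define c where "c = cnj (cform u x) / cmod (cform u x)"
  have c: "cmod c = 1"
    using False by (simp add: c_def norm_divide)
  have "c * cform u x = cmod (cform u x)"
    using False complex_norm_square[of "cform u x"] by (simp add: c_def field_simps power2_eq_square)
  then have "cmod (cform u x) = Re (cform u (c *s x))"
    by (simp add: cform_scale)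
  also have "\<dots> \<le> norm u * norm (c *s x)"
    by (simp add: Re_cform norm_cauchy_schwarz)
  finally show ?thesis
    by (simp add: norm_complex_vector_scale c)
qed simp

lemma separating_cform:
  fixes \<Omega> :: "(complex^'d) set"
  assumes "open \<Omega>" "convex \<Omega>" "\<xi> \<notin> \<Omega>"
  obtains u where "norm u = 1" "\<And>x. x \<in> \<Omega> \<Longrightarrow> 0 < Re (cform u (\<xi> - x))"
proof (cases "\<Omega> = {}")
  case True
  then show ?thesis
    using that[of "SOME b. b \<in> Basis"] by simp
next
  case False
  obtain a b where a: "a \<noteq> 0" "\<And>x. x \<in> \<Omega> \<Longrightarrow> inner a x \<le> b" "b \<le> inner a \<xi>"
    using separating_hyperplane_sets[of \<Omega> "{\<xi>}"] assms False by auto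
  define u where "u = a /\<^sub>R norm a"
  have "0 < inner u (\<xi> - x)" if x: "x \<in> \<Omega>" for x
  proof -
    obtain e where e: "0 < e" "ball x e \<subseteq> \<Omega>"
      using assms(1) x by (meson openE)
    \<comment> \<open>Separation gives only a weak inequality. Moving \<open>x\<close> slightly
      towards the hyperplane stays in the open set, so the inequality is strict at
      \<open>x\<close>.\<close>
    define y where "y = x + (e / (2 * norm a)) *\<^sub>R a"
    have "y \<in> ball x e"
      using e a(1) by (simp add: y_def dist_norm)
    then have "inner a y \<le> inner a \<xi>"
      using e a by (meson order_trans subsetD)
    moreover have "inner a y = inner a x + (e / (2 * norm a)) * inner a a"
      by (simp add: y_def inner_add_right)
    moreover have "0 < (e / (2 * norm a)) * inner a a"
      using e a(1) by simp
    ultimately have "0 < inner a (\<xi> - x)"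
      by (simp add: inner_diff_right)
    then show ?thesis
      using a(1) by (simp add: u_def)
  qed
  then show ?thesis
    using that[of u] a(1) by (simp add: u_def Re_cform)
qed

text \<open>Along the disc the functional is holomorphic with values in the right half-plane, and
  \<open>\<xi>\<close> cancels in the difference of two values.\<close>

lemma holo_disc_cform_estimate:
  assumes "\<And>x. x \<in> \<Omega> \<Longrightarrow> 0 < Re (cform u (\<xi> - x))" "holo_disc f \<Omega>" "cmod z < 1" "cmod w < 1"
  shows "cmod (cform u (f z - f w)) \<le> cmod ((z - w) / (1 - cnj z * w)) *
    (cmod (cform u (\<xi> - f z)) + cmod (cform u (\<xi> - f w)))"
proof -
  have "(\<lambda>x. cform u (\<xi> - f x)) holomorphic_on ball 0 1"
    using assms(2) unfolding holo_disc_def cform_def by (auto intro!: holomorphic_intros)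
  moreover have "0 < Re (cform u (\<xi> - f x))" if "cmod x < 1" for x
    using assms(2) that by (intro assms(1)) (auto simp: holo_disc_def)
  ultimately have "cmod (cform u (\<xi> - f z) - cform u (\<xi> - f w)) \<le> cmod ((z - w) / (1 - cnj z * w)) *
    (cmod (cform u (\<xi> - f z)) + cmod (cform u (\<xi> - f w)))"
    using assms by (intro Schwarz_Pick_right_half_plane)
  then show ?thesis
    by (simp add: cform_diff norm_minus_commute)
qed

text \<open>For \<open>\<xi> = f w + c *s v\<close> outside the domain, all terms of the half-plane
  estimate are multiples of \<open>l = cform u v\<close>. Dividing by \<open>cmod l\<close> leaves
  \<open>1 \<le> \<rho> * (2 * cmod c + 1)\<close>, a lower bound on \<open>cmod c\<close> and so on
  the distance to \<open>\<xi>\<close>. The bound by \<open>\<delta>\<close> is asked for distinct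
  points only, since local m-convexity speaks of nonzero directions.\<close>

lemma norm_diff_le_bdist_dir:
  fixes \<Omega> :: "(complex^'d) set"
  assumes \<Omega>: "open \<Omega>" "convex \<Omega>" "C_proper \<Omega>" and f: "holo_disc f \<Omega>"
    and z: "cmod z < 1" and w: "cmod w < 1" and \<rho>: "cmod ((z - w) / (1 - cnj z * w)) \<le> \<rho>" "\<rho> < 1"
    and \<delta>: "f z \<noteq> f w \<Longrightarrow> bdist_dir \<Omega> (f w) (f z - f w) \<le> \<delta>" "0 \<le> \<delta>"
  shows "norm (f z - f w) \<le> 2 * \<rho> / (1 - \<rho>) * \<delta>"
proof (cases "f z = f w")
  case True
  have "0 \<le> \<rho>" using \<rho>(1) norm_ge_zero order_trans by blast
  with True show ?thesis using \<rho>(2) \<delta>(2) by simp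
next
  case False
  define v where "v = f z - f w"
  have \<rho>0: "0 \<le> \<rho>" using \<rho>(1) norm_ge_zero order_trans by blast
  have v: "v \<noteq> 0" using False by (simp add: v_def)
  define K where "K = 2 * \<rho> / (1 - \<rho>)"
  have K0: "0 \<le> K" using \<rho>0 \<rho>(2) by (simp add: K_def)
  \<comment> \<open>\<open>infdist\<close> to the empty set is 0 by convention; C-properness makes
    the directional distance a true infimum.\<close>
  have ne: "cline (f w) v - \<Omega> \<noteq> {}"
    using \<Omega>(3) v by (auto simp: C_proper_def)
  have key: "norm v \<le> K * dist (f w) \<xi>" if \<xi>: "\<xi> \<in> cline (f w) v - \<Omega>" for \<xi>
  proof -
    obtain c where c: "\<xi> = f w + c *s v"
      using \<xi> by (auto simp: cline_def)
    obtain u where u: "norm u = 1" "\<And>x. x \<in> \<Omega> \<Longrightarrow> 0 < Re (cform u (\<xi> - x))"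
      using separating_cform[of \<Omega> \<xi>] \<Omega> \<xi> by auto
    define l where "l = cform u v"
    have fw: "f w \<in> \<Omega>" 
      using f w by (auto simp: holo_disc_def)
    have 1: "cform u (\<xi> - f w) = c * l"
      by (simp add: c l_def cform_scale)
    have l: "l \<noteq> 0"
      using u(2)[OF fw] 1 by auto
    have 2: "cform u (\<xi> - f z) = c * l - l"
      using 1 by (simp add: l_def v_def cform_diff diff_eq_eq)
    have "cmod l \<le> cmod ((z - w) / (1 - cnj z * w)) * (cmod (c * l - l) + cmod (c * l))"
      using holo_disc_cform_estimate[OF u(2) f z w] unfolding 1 2 by (simp add: l_def v_def)
    also have "\<dots> \<le> \<rho> * ((cmod (c * l) + cmod l) + cmod (c * l))"
      using \<rho> \<rho>0 by (intro mult_mono) (auto intro: norm_triangle_ineq4)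
    finally have "cmod l * 1 \<le> cmod l * (\<rho> * (2 * cmod c + 1))"
      by (simp add: norm_mult algebra_simps)
    then have "1 \<le> \<rho> * (2 * cmod c + 1)"
      using l by (subst (asm) mult_le_cancel_left_pos) auto
    then have "1 \<le> K * cmod c"
      using \<rho>(2) by (simp add: K_def field_simps)
    then have "norm v \<le> (K * cmod c) * norm v"
      by (metis mult_right_mono mult_1 norm_ge_zero)
    then show ?thesis
      by (simp add: c dist_norm norm_complex_vector_scale mult.assoc)
  qed
  \<comment> \<open>The infimum bound divides by \<open>K\<close>; for \<open>K = 0\<close> the
    estimate \<open>key\<close> would force \<open>v = 0\<close>.\<close>
  have "norm v \<le> K * infdist (f w) (cline (f w) v - \<Omega>)"
  proof (cases "K = 0")
    case True
    then show ?thesis using key ne v by fastforce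
  next
    case False
    then have K: "K > 0" using K0 by simp
    have "norm v / K \<le> infdist (f w) (cline (f w) v - \<Omega>)"
      unfolding infdist_def if_not_P[OF ne]
      using ne key K by (intro cINF_greatest) (auto simp: pos_divide_le_eq mult.commute)
    then show ?thesis using K by (simp add: field_simps)
  qed
  also have "\<dots> \<le> K * \<delta>"
    using \<delta>(1)[OF False] K0 by (intro mult_left_mono) (auto simp: bdist_dir_def v_def)
  finally show ?thesis
    by (simp add: v_def K_def)
qed

section \<open>Distance to the complement of the domain\<close>

lemma C_proper_not_UNIV: "C_proper (\<Omega> :: (complex^'d) set) \<Longrightarrow> - \<Omega> \<noteq> {}"
  unfolding C_proper_def by (metis Compl_eq_Diff_UNIV Diff_eq_empty_iff UNIV_I subset_eq zero_neq_one)

lemma ball_bdist_subset: "ball p (bdist \<Omega> p) \<subseteq> \<Omega>"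
  unfolding bdist_def by (smt (verit) ComplI infdist_le mem_ball subsetI)

text \<open>C-properness supplies a point of the complement; with an empty complement
  \<open>infdist\<close> would be 0 by convention.\<close>

lemma le_bdistI:
  assumes "C_proper (\<Omega> :: (complex^'d) set)" "\<And>\<xi>. \<xi> \<notin> \<Omega> \<Longrightarrow> r \<le> dist p \<xi>"
  shows "r \<le> bdist \<Omega> p"
  using C_proper_not_UNIV[OF assms(1)] assms(2)
  by (auto simp: bdist_def infdist_def intro!: cINF_greatest)

lemma bdist_pos: 
  assumes "open \<Omega>" "C_proper (\<Omega> :: (complex^'d) set)" "p \<in> \<Omega>"
  shows "0 < bdist \<Omega> p"
proof -
  obtain e where "e > 0" "ball p e \<subseteq> \<Omega>"
    using assms by (meson openE)
  then show ?thesis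
    using le_bdistI[of \<Omega> e p] assms(2) by (fastforce simp: not_less[symmetric])
qed

text \<open>A Harnack-type bound: the modulus of the separating functional is at least the boundary
  distance at \<open>f 0\<close> and at most \<open>dist (f z) \<xi>\<close> at \<open>f z\<close>,
  and Schwarz-Pick with \<open>w = 0\<close> compares the two. It keeps limit discs off the
  boundary.\<close>

lemma bdist_holo_disc_ge:
  fixes \<Omega> :: "(complex^'d) set"
  assumes \<Omega>: "open \<Omega>" "convex \<Omega>" "C_proper \<Omega>" and f: "holo_disc f \<Omega>" and z: "cmod z < 1"
  shows "(1 - cmod z) / (1 + cmod z) * bdist \<Omega> (f 0) \<le> bdist \<Omega> (f z)"
proof (rule le_bdistI[OF \<Omega>(3)])
  fix \<xi> assume \<xi>: "\<xi> \<notin> \<Omega>"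
  define c where "c = bdist \<Omega> (f 0)"
  obtain u where u: "norm u = 1" "\<And>x. x \<in> \<Omega> \<Longrightarrow> 0 < Re (cform u (\<xi> - x))"
    using separating_cform[of \<Omega> \<xi>] \<Omega> \<xi> by auto
  have f0: "f 0 \<in> \<Omega>" using f by (auto simp: holo_disc_def)
  have c0: "0 < c" using bdist_pos[OF \<Omega>(1,3) f0] by (simp add: c_def)
  have "c \<le> Re (cform u (\<xi> - f 0))"
  proof (rule field_le_mult_one_interval)
    fix s :: real assume s: "0 < s" "s < 1"
    \<comment> \<open>The ball is open, so the point at distance \<open>c\<close> along
      \<open>u\<close> is approached through factors \<open>s < 1\<close>.\<close>
    have "f 0 + (s * c) *\<^sub>R u \<in> ball (f 0) c"
      using s c0 u(1) by (simp add: dist_norm)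
    then have "f 0 + (s * c) *\<^sub>R u \<in> \<Omega>"
      using ball_bdist_subset[of "f 0" \<Omega>] by (auto simp: c_def)
    from u(2)[OF this] show "s * c \<le> Re (cform u (\<xi> - f 0))"
      by (simp add: Re_cform inner_add_right inner_diff_right dot_square_norm u(1))
  qed
  also have "\<dots> \<le> cmod (cform u (\<xi> - f 0))"
    by (rule complex_Re_le_cmod)
  finally have c_le: "c \<le> cmod (cform u (\<xi> - f 0))" .
  have "cmod (cform u (\<xi> - f 0)) - cmod (cform u (\<xi> - f z)) \<le> cmod (cform u (\<xi> - f 0) - cform u (\<xi> - f z))"
    by (rule norm_triangle_ineq2)
  also have "\<dots> = cmod (cform u (f z - f 0))"
    by (simp add: cform_diff)
  also have "\<dots> \<le> cmod z * (cmod (cform u (\<xi> - f z)) + cmod (cform u (\<xi> - f 0)))"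
    using holo_disc_cform_estimate[OF u(2) f z, of 0] by simp
  finally have "(1 - cmod z) * cmod (cform u (\<xi> - f 0)) \<le> (1 + cmod z) * cmod (cform u (\<xi> - f z))"
    by (simp add: algebra_simps)
  also have "\<dots> \<le> (1 + cmod z) * dist (f z) \<xi>"
    using cmod_cform_le[of u "\<xi> - f z"] u(1) by (intro mult_left_mono) (auto simp: dist_norm norm_minus_commute)
  finally have "(1 - cmod z) * c \<le> (1 + cmod z) * dist (f z) \<xi>"
    using c_le z by (meson diff_ge_0_iff_ge less_imp_le mult_left_mono order_trans)
  moreover have "0 < 1 + cmod z"
    using norm_ge_zero[of z] by linarith
  ultimately show "(1 - cmod z) / (1 + cmod z) * bdist \<Omega> (f 0) \<le> dist (f z) \<xi>"
    by (simp add: c_def[symmetric] field_simps)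
qed

section \<open>Chains of discs\<close>

lemma artanh_real_mono:
  assumes "0 \<le> x" "x \<le> y" "y < (1::real)"
  shows "artanh x \<le> artanh y"
proof -
  have "(1 + x) / (1 - x) \<le> (1 + y) / (1 - y)"
    using assms by (intro frac_le) auto
  then show ?thesis
    using assms by (simp add: artanh_def)
qed

lemma artanh_half: "artanh (1/2 :: real) = ln 3 / 2"
  by (simp add: artanh_def)

lemma poincare_dist_commute: "poincare_dist z w = poincare_dist w z"
proof -
  have "cnj (1 - cnj z * w) = 1 - cnj w * z"
    by simp
  then have "cmod (1 - cnj z * w) = cmod (1 - cnj w * z)"
    by (metis complex_mod_cnj)
  then show ?thesis
    by (simp add: poincare_dist_def norm_divide norm_minus_commute)
qed

lemma poincare_dist_nonneg:
  assumes "cmod z < 1" "cmod w < 1"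
  shows "0 \<le> poincare_dist z w"
  using artanh_real_mono[of 0] pseudo_hyperbolic_lt_1[OF assms]
  by (auto simp: poincare_dist_def)

lemma poincare_dist_0: "poincare_dist 0 w = artanh (cmod w)"
  by (simp add: poincare_dist_def)

lemma poincare_dist_minus: "poincare_dist (- z) (- w) = poincare_dist z w"
  by (simp add: poincare_dist_def norm_minus_commute norm_divide)

text \<open>Continuity at \<open>s = 1\<close>. This is the cost of replacing a disc by its
  restriction to radius \<open>s\<close>, whose image has compact closure in the domain.\<close>

lemma poincare_dist_dilate:
  assumes ab: "cmod a < 1" "cmod b < 1" and e: "0 < e"
  obtains s where "0 < s" "s < 1" "cmod a < s" "cmod b < s"
    "poincare_dist (a / of_real s) (b / of_real s) < poincare_dist a b + e"
proof -
  have "((\<lambda>s. poincare_dist (a / of_real s) (b / of_real s)) \<longlongrightarrow>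
      poincare_dist (a / of_real 1) (b / of_real 1)) (at_left 1)"
    unfolding poincare_dist_def using pseudo_hyperbolic_lt_1[OF ab] norm_ge_zero[of "(a - b) / (1 - cnj a * b)"]
    by (intro tendsto_intros) (auto simp del: norm_ge_zero)
  then have "\<forall>\<^sub>F s in at_left 1. poincare_dist (a / of_real s) (b / of_real s) < poincare_dist a b + e"
    using e by (intro order_tendstoD(2)) auto
  moreover have "\<forall>\<^sub>F s in at_left (1::real). s \<in> {max 0 (max (cmod a) (cmod b))<..<1}"
    using ab by (intro eventually_at_left_real) auto
  ultimately have "\<forall>\<^sub>F s in at_left 1. s \<in> {max 0 (max (cmod a) (cmod b))<..<1} \<and>
      poincare_dist (a / of_real s) (b / of_real s) < poincare_dist a b + e"
    by eventually_elim auto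
  then obtain s where "s \<in> {max 0 (max (cmod a) (cmod b))<..<1}"
      "poincare_dist (a / of_real s) (b / of_real s) < poincare_dist a b + e"
    using eventually_happens'[OF trivial_limit_at_left_real] by blast
  then show ?thesis
    using that by auto
qed

section \<open>Chains of discs and the Kobayashi distance\<close>

lemma holo_disc_imp_continuous_on:
  assumes "holo_disc f \<Omega>"
  shows "continuous_on (ball 0 1) f"
proof -
  have "continuous_on (ball 0 1) (\<lambda>z. \<chi> i. f z $ i)"
    using assms by (intro continuous_on_vec_lambda holomorphic_on_imp_continuous_on) (auto simp: holo_disc_def)
  then show ?thesis
    by (simp only: vec_nth_inverse)
qed

text \<open>Growing chains by one disc, with the length as an argument, lets concatenation, reversal
  and transfer be proved by induction instead of by indexing families.\<close>

inductive disc_chain :: "(complex^'d) set \<Rightarrow> complex^'d \<Rightarrow> complex^'d \<Rightarrow> real \<Rightarrow> bool" for \<Omega> where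
  disc: "holo_disc f \<Omega> \<Longrightarrow> cmod a < 1 \<Longrightarrow> cmod b < 1 \<Longrightarrow> disc_chain \<Omega> (f a) (f b) (poincare_dist a b)"
| snoc: "disc_chain \<Omega> p (f a) l \<Longrightarrow> holo_disc f \<Omega> \<Longrightarrow> cmod a < 1 \<Longrightarrow> cmod b < 1 \<Longrightarrow>
    disc_chain \<Omega> p (f b) (l + poincare_dist a b)"

lemma kobayashi_dist_eq_Inf_disc_chain: "kobayashi_dist \<Omega> p q = Inf {l. disc_chain \<Omega> p q l}"
proof -
  have 1: "(\<exists>n f a b. l = (\<Sum>i<n. poincare_dist (a i) (b i)) \<and> n \<ge> 1 \<and>
      (\<forall>i<n. holo_disc (f i) \<Omega> \<and> a i \<in> ball 0 1 \<and> b i \<in> ball 0 1)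
      \<and> f 0 (a 0) = p \<and> f (n - 1) (b (n - 1)) = q
      \<and> (\<forall>i. Suc i < n \<longrightarrow> f i (b i) = f (Suc i) (a (Suc i))))"
    if "disc_chain \<Omega> p q l" for l
    using that
  proof (induction rule: disc_chain.induct)
    case (disc f a b)
    then show ?case
      by (intro exI[of _ 1] exI[of _ "\<lambda>_. f"] exI[of _ "\<lambda>_. a"] exI[of _ "\<lambda>_. b"]) auto
  next
    case (snoc p f a l b)
    then obtain n F A B where IH: "l = (\<Sum>i<n. poincare_dist (A i) (B i))" "n \<ge> 1"
      "\<And>i. i < n \<Longrightarrow> holo_disc (F i) \<Omega> \<and> A i \<in> ball 0 1 \<and> B i \<in> ball 0 1"
      "F 0 (A 0) = p" "F (n - 1) (B (n - 1)) = f a"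
      "\<And>i. Suc i < n \<Longrightarrow> F i (B i) = F (Suc i) (A (Suc i))"
      by blast
    \<comment> \<open>The only new junction is at \<open>Suc i = n\<close>, where the old chain ends
      at \<open>f a\<close>.\<close>
    have step: "(F(n := f)) i ((B(n := b)) i) = (F(n := f)) (Suc i) ((A(n := a)) (Suc i))" if "Suc i < Suc n" for i
      using IH(5,6) that by (cases "Suc i = n") auto
    show ?case
      using IH snoc(2-4) step
      by (intro exI[of _ "Suc n"] exI[of _ "F(n := f)"] exI[of _ "A(n := a)"] exI[of _ "B(n := b)"])
        (auto simp: less_Suc_eq)
  qed
  \<comment> \<open>Chains in the Kobayashi infimum are nonempty, so the count is
    \<open>Suc n\<close> and the induction starts from one disc.\<close>
  have "disc_chain \<Omega> (f 0 (a 0)) (f n (b n)) (\<Sum>i<Suc n. poincare_dist (a i) (b i))"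
    if "\<And>i. i < Suc n \<Longrightarrow> holo_disc (f i) \<Omega> \<and> a i \<in> ball 0 1 \<and> b i \<in> ball 0 1"
      "\<And>i. Suc i < Suc n \<Longrightarrow> f i (b i) = f (Suc i) (a (Suc i))" for n f a b
    using that
  proof (induction n)
    case 0
    then show ?case
      using disc[of "f 0" \<Omega> "a 0" "b 0"] by simp
  next
    case (Suc n)
    have "disc_chain \<Omega> (f 0 (a 0)) (f (Suc n) (a (Suc n))) (\<Sum>i<Suc n. poincare_dist (a i) (b i))"
      using Suc.IH Suc.prems by (metis lessI less_SucI)
    from snoc[of \<Omega> _ "f (Suc n)" "a (Suc n)", OF this] show ?case
      using Suc.prems(1)[of "Suc n"] by simp
  qed
  then have 2: "disc_chain \<Omega> p q l"
    if "l = (\<Sum>i<n. poincare_dist (a i) (b i))" "n \<ge> 1" "\<forall>i<n. holo_disc (f i) \<Omega> \<and> a i \<in> ball 0 1 \<and> b i \<in> ball 0 1"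
      "f 0 (a 0) = p" "f (n - 1) (b (n - 1)) = q"
      "\<forall>i. Suc i < n \<longrightarrow> f i (b i) = f (Suc i) (a (Suc i))" for l n f a b
    using that by (cases n) auto
  show ?thesis
    unfolding kobayashi_dist_def
    by (intro arg_cong[of _ _ Inf] Collect_cong iffI) (elim exE conjE, rule 2, assumption+, rule 1)
qed

lemma disc_chain_nonneg: "disc_chain \<Omega> p q l \<Longrightarrow> 0 \<le> l"
  by (induction rule: disc_chain.induct) (auto simp: poincare_dist_nonneg)

lemma kobayashi_dist_le: "disc_chain \<Omega> p q l \<Longrightarrow> kobayashi_dist \<Omega> p q \<le> l"
  unfolding kobayashi_dist_eq_Inf_disc_chain
  by (rule cInf_lower) (auto intro!: bdd_belowI[of _ 0] disc_chain_nonneg)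

text \<open>The later chain is the first premise because the induction runs along it, adding its
  discs to the chain from \<open>p\<close> to \<open>q\<close>.\<close>

lemma disc_chain_trans:
  assumes "disc_chain \<Omega> q r l'" "disc_chain \<Omega> p q l"
  shows "disc_chain \<Omega> p r (l + l')"
  using assms
proof (induction rule: disc_chain.induct)
  case (snoc q f a k b)
  then have "disc_chain \<Omega> p (f b) (l + k + poincare_dist a b)"
    by (intro disc_chain.snoc) auto
  then show ?case
    by (simp add: add.assoc)
qed (auto intro: snoc)

lemma disc_chain_sym: "disc_chain \<Omega> p q l \<Longrightarrow> disc_chain \<Omega> q p l"
proof (induction rule: disc_chain.induct)
  case (disc f a b)
  then show ?case
    by (metis disc_chain.disc poincare_dist_commute)
next
  case (snoc p f a l b)
  then have "disc_chain \<Omega> (f b) (f a) (poincare_dist a b)"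
    by (metis disc_chain.disc poincare_dist_commute)
  then show ?case
    using disc_chain_trans snoc.IH by (metis add.commute)
qed

lemma disc_chain_refl: 
  assumes "p \<in> \<Omega>"
  shows "disc_chain \<Omega> p p 0"
proof -
  have "holo_disc (\<lambda>_. p) \<Omega>"
    using assms by (auto simp: holo_disc_def)
  from disc[OF this, of 0 0] show ?thesis
    by (simp add: poincare_dist_0)
qed

text \<open>A single affine disc centred at \<open>x\<close>, of radius \<open>r\<close> in the
  direction of \<open>y\<close>, passes through \<open>y\<close> at the parameter
  \<open>dist x y / r\<close>.\<close>

lemma disc_chain_ball:
  assumes "ball x r \<subseteq> \<Omega>" "dist x y < r"
  shows "disc_chain \<Omega> x y (artanh (dist x y / r))"
proof (cases "x = y")
  case True
  then show ?thesis
    using assms disc_chain_refl[of y \<Omega>] by (auto simp: subset_iff)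
next
  case False
  define f where "f = (\<lambda>z. x + (z * of_real (r / dist x y)) *s (y - x))"
  have r: "0 < r"
    using assms(2) by (meson zero_le_dist le_less_trans)
  have "(\<lambda>z. f z $ i) holomorphic_on ball 0 1" for i
    unfolding f_def vector_add_component vector_smult_component by (intro holomorphic_intros)
  moreover have "f z \<in> \<Omega>" if "cmod z < 1" for z
  proof -
    have "dist x (f z) = cmod z * r"
      using r False unfolding f_def dist_norm
      by (simp add: norm_complex_vector_scale norm_mult norm_divide norm_minus_commute del: vector_ssub_ldistrib)
    then have "f z \<in> ball x r"
      using that r by simp
    then show ?thesis
      using assms(1) by auto
  qed
  ultimately have "holo_disc f \<Omega>"
    by (auto simp: holo_disc_def)
  from disc[OF this, of 0 "of_real (dist x y / r)"] 
  have "disc_chain \<Omega> (f 0) (f (of_real (dist x y / r))) (artanh (dist x y / r))"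
    using assms(2) r by (simp add: poincare_dist_0 norm_divide)
  moreover have "f 0 = x" "f (of_real (dist x y / r)) = y"
    using r False by (simp_all add: f_def del: of_real_divide flip: of_real_mult)
  ultimately show ?thesis
    by simp
qed

text \<open>The bound \<open>artanh (1/2)\<close> for such a step does not depend on the scale, so
  lengths of chains can be bounded by counting steps.\<close>

lemma disc_chain_ball_half:
  assumes "ball x r \<subseteq> \<Omega>" "dist x y \<le> r / 2" "0 < r"
  obtains l where "l \<le> ln 3 / 2" "disc_chain \<Omega> x y l"
proof
  show "disc_chain \<Omega> x y (artanh (dist x y / r))"
    using assms by (intro disc_chain_ball) auto
  show "artanh (dist x y / r) \<le> ln 3 / 2"
    unfolding artanh_half[symmetric] using assms by (intro artanh_real_mono) (auto simp: field_simps)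
qed

text \<open>Restrict each disc to a slightly smaller radius and rescale.\<close>

lemma disc_chain_transfer:
  assumes "disc_chain \<Omega> p q l" "0 < e"
  shows "\<exists>K. compact K \<and> K \<subseteq> \<Omega> \<and> (\<forall>\<Omega>'. K \<subseteq> \<Omega>' \<longrightarrow> (\<exists>l'\<le>l + e. disc_chain \<Omega>' p q l'))"
proof -
  have *: "\<exists>K. compact K \<and> K \<subseteq> \<Omega> \<and> (\<forall>\<Omega>'. K \<subseteq> \<Omega>' \<longrightarrow> (\<exists>l'\<le>poincare_dist a b + e. disc_chain \<Omega>' (f a) (f b) l'))"
    if f: "holo_disc f \<Omega>" and ab: "cmod a < 1" "cmod b < 1" and e: "0 < e" for f a b and e :: real
  proof -
    obtain s where s: "0 < s" "s < 1" "cmod a < s" "cmod b < s"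
        "poincare_dist (a / of_real s) (b / of_real s) < poincare_dist a b + e"
      using poincare_dist_dilate[OF ab e] by blast
    have sub: "cball 0 s \<subseteq> ball (0::complex) 1"
      using s by auto
    have "continuous_on (ball 0 1) f"
      using f by (rule holo_disc_imp_continuous_on)
    then have "compact (f ` cball 0 s)"
      using sub by (meson compact_cball compact_continuous_image continuous_on_subset)
    moreover have "f ` cball 0 s \<subseteq> \<Omega>"
      using f sub by (auto simp: holo_disc_def)
    moreover have "\<exists>l'\<le>poincare_dist a b + e. disc_chain \<Omega>' (f a) (f b) l'" if K: "f ` cball 0 s \<subseteq> \<Omega>'" for \<Omega>'
    proof -
      have scale: "cmod (of_real s * z) < s" if "cmod z < 1" for z
        using that s(1) by (simp add: norm_mult)
      have "(\<lambda>z. f (of_real s * z) $ i) holomorphic_on ball 0 1" for i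
      proof -
        have "(\<lambda>z. of_real s * z) holomorphic_on ball 0 1"
          by (intro holomorphic_intros)
        moreover have "(\<lambda>z. f z $ i) holomorphic_on ball 0 1"
          using f by (simp add: holo_disc_def)
        moreover have "(\<lambda>z::complex. of_real s * z) ` ball 0 1 \<subseteq> ball 0 1"
          by (auto intro: less_trans[OF scale s(2)])
        ultimately show ?thesis
          using holomorphic_on_compose_gen[of "\<lambda>z. of_real s * z" "ball 0 1" "\<lambda>z. f z $ i" "ball 0 1"]
          by (simp add: o_def)
      qed
      moreover have "f (of_real s * z) \<in> \<Omega>'" if "cmod z < 1" for z
        using K scale[OF that] by (auto intro: less_imp_le)
      ultimately have "holo_disc (\<lambda>z. f (of_real s * z)) \<Omega>'"
        by (auto simp: holo_disc_def)
      from disc[OF this, of "a / of_real s" "b / of_real s"] show ?thesis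
        using s by (intro exI[of _ "poincare_dist (a / of_real s) (b / of_real s)"]) (auto simp: norm_divide)
    qed
    ultimately show ?thesis
      by blast
  qed
  show ?thesis
    using assms
  proof (induction arbitrary: e rule: disc_chain.induct)
    case (disc f a b)
    then show ?case by (rule *)
  next
    case (snoc p f a l b)
    obtain K where K: "compact K" "K \<subseteq> \<Omega>" "\<And>\<Omega>'. K \<subseteq> \<Omega>' \<Longrightarrow> \<exists>l'\<le>l + e/2. disc_chain \<Omega>' p (f a) l'"
      using snoc.IH[of "e/2"] snoc.prems by auto
    obtain K' where K': "compact K'" "K' \<subseteq> \<Omega>"
        "\<And>\<Omega>'. K' \<subseteq> \<Omega>' \<Longrightarrow> \<exists>l'\<le>poincare_dist a b + e/2. disc_chain \<Omega>' (f a) (f b) l'"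
      using *[of f a b "e/2"] snoc by auto
    have "\<exists>l'\<le>l + poincare_dist a b + e. disc_chain \<Omega>' p (f b) l'" if "K \<union> K' \<subseteq> \<Omega>'" for \<Omega>'
    proof -
      obtain k k' where "k \<le> l + e/2" "disc_chain \<Omega>' p (f a) k"
          "k' \<le> poincare_dist a b + e/2" "disc_chain \<Omega>' (f a) (f b) k'"
        using K(3) K'(3) \<open>K \<union> K' \<subseteq> \<Omega>'\<close> by (meson Un_subset_iff)
      then show ?thesis
        using disc_chain_trans[of \<Omega>' "f a" "f b" k' p k] by (intro exI[of _ "k + k'"]) auto
    qed
    then show ?case
      using K K' by (intro exI[of _ "K \<union> K'"]) auto
  qed
qed

section \<open>Decay of the boundary distance along geodesics\<close>

text \<open>Walk from \<open>c\<close> towards \<open>y\<close>, keeping the fraction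
  \<open>q\<close> of the remaining distance at each step. After \<open>N\<close> steps the walk is
  within \<open>\<delta> / 2\<close> of \<open>y\<close> and one more disc ends it. Thus a number of
  steps of order log(1/\<open>\<delta>\<close>) suffices.\<close>

lemma disc_chain_from_ball_center:
  assumes \<Omega>: "convex \<Omega>" and r: "0 < r" "ball c r \<subseteq> \<Omega>" and \<delta>: "0 < \<delta>" "ball y \<delta> \<subseteq> \<Omega>"
    and D: "dist c y \<le> D" "r \<le> D" and N: "(1 - r / (2 * D)) ^ N * D \<le> \<delta> / 2"
  obtains l where "l \<le> (real N + 1) * (ln 3 / 2)" "disc_chain \<Omega> c y l"
proof -
  define q where "q = 1 - r / (2 * D)"
  have D0: "0 < D" using r D by simp
  have q: "0 < q" "q \<le> 1"
    using r D D0 by (auto simp: q_def field_simps)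
  \<comment> \<open>Step length and radius of the surrounding ball both scale with \<open>q\<^sup>j\<close>, so every step has bounded cost.\<close>
  define Y where "Y = (\<lambda>j. y + (q ^ j) *\<^sub>R (c - y))"
  have ball: "ball (Y j) (q ^ j * r) \<subseteq> \<Omega>" for j
  proof
    fix z assume z: "z \<in> ball (Y j) (q ^ j * r)"
    have s: "0 < q ^ j" "q ^ j \<le> 1"
      using q by (auto simp: power_le_one)
    \<comment> \<open>The homothety with centre \<open>y\<close> and ratio \<open>q ^ j\<close> maps
      the ball around \<open>c\<close> onto the ball around \<open>Y j\<close>; \<open>w\<close> is
      the preimage of \<open>z\<close>.\<close>
    define w where "w = c + (1 / q ^ j) *\<^sub>R (z - Y j)"
    have "w \<in> ball c r"
      using z s by (simp add: w_def dist_norm norm_minus_commute divide_simps mult.commute)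
    moreover have "y \<in> \<Omega>" using \<delta> by auto
    ultimately have "(1 - q ^ j) *\<^sub>R y + q ^ j *\<^sub>R w \<in> \<Omega>"
      using \<Omega> r s by (intro convexD) auto
    also have "(1 - q ^ j) *\<^sub>R y + q ^ j *\<^sub>R w = z"
    proof -
      have "q ^ j *\<^sub>R w = q ^ j *\<^sub>R c + (z - Y j)"
        unfolding w_def scaleR_add_right scaleR_scaleR using s(1) q by simp
      then show ?thesis
        by (simp add: Y_def algebra_simps)
    qed
    finally show "z \<in> \<Omega>" .
  qed
  have "\<exists>l\<le>real j * (ln 3 / 2). disc_chain \<Omega> c (Y j) l" for j
  proof (induction j)
    case 0
    then show ?case
      using disc_chain_refl[of c \<Omega>] r by (auto simp: Y_def subset_iff)
  next
    case (Suc j)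
    have "Y j - Y (Suc j) = (q ^ j * (r / (2 * D))) *\<^sub>R (c - y)"
      by (simp add: Y_def q_def algebra_simps)
    then have "dist (Y j) (Y (Suc j)) = q ^ j * (r / (2 * D)) * dist c y"
      using q r D0 by (simp add: dist_norm)
    also have "\<dots> \<le> q ^ j * (r / (2 * D)) * D"
      using D D0 q r by (intro mult_left_mono) auto
    also have "\<dots> = q ^ j * r / 2"
      using D0 by simp
    finally obtain k where "k \<le> ln 3 / 2" "disc_chain \<Omega> (Y j) (Y (Suc j)) k"
      using disc_chain_ball_half[OF ball] q r by (metis mult_pos_pos zero_less_power)
    moreover obtain l where "l \<le> real j * (ln 3 / 2)" "disc_chain \<Omega> c (Y j) l"
      using Suc by blast
    ultimately show ?case
      using disc_chain_trans by (intro exI[of _ "l + k"]) (auto simp: algebra_simps)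
  qed
  then obtain l where l: "l \<le> real N * (ln 3 / 2)" "disc_chain \<Omega> c (Y N) l"
    by blast
  have "dist y (Y N) = q ^ N * dist c y"
    using q by (simp add: Y_def dist_norm)
  also have "\<dots> \<le> q ^ N * D"
    using D q by (intro mult_left_mono) auto
  also have "\<dots> \<le> \<delta> / 2"
    using N by (simp add: q_def)
  finally obtain k where k: "k \<le> ln 3 / 2" "disc_chain \<Omega> y (Y N) k"
    using disc_chain_ball_half[OF \<delta>(2) _ \<delta>(1)] by blast
  from k(2) have "disc_chain \<Omega> c y (l + k)"
    using l(2) disc_chain_trans disc_chain_sym by blast
  moreover have "l + k \<le> (real N + 1) * (ln 3 / 2)"
    using l(1) k(1) by (simp add: algebra_simps)
  ultimately show ?thesis
    using that by blast
qed

text \<open>The hypothesis \<open>\<delta>(f z) \<le> \<delta>(f 0)\<close> lets one chain length \<open>N\<close> serve both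
  \<open>f 0\<close> and \<open>f z\<close>; if \<open>\<delta>(f z)\<close> were too large, going through \<open>c\<close> would be a shortcut.\<close>

lemma complex_geodesic_bdist_decay:
  fixes \<Omega> :: "(complex^'d) set"
  assumes \<Omega>: "open \<Omega>" "convex \<Omega>" "C_proper \<Omega>" and f: "complex_geodesic \<Omega> f"
    and r: "0 < r" "ball c r \<subseteq> \<Omega>" and D: "dist c (f 0) \<le> D" "dist c (f z) \<le> D" "r \<le> D"
    and z: "cmod z < 1" "1 - (1/16) ^ Suc N \<le> cmod z"
    and le: "bdist \<Omega> (f z) \<le> bdist \<Omega> (f 0)"
  shows "bdist \<Omega> (f z) \<le> 2 * D * (1 - r / (2 * D)) ^ N"
proof (rule ccontr)
  assume *: "\<not> ?thesis"
  have fin: "f 0 \<in> \<Omega>" "f z \<in> \<Omega>"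
    using f z by (auto simp: complex_geodesic_def holo_disc_def)
  obtain l where l: "l \<le> (real N + 1) * (ln 3 / 2)" "disc_chain \<Omega> c (f 0) l"
    using disc_chain_from_ball_center[OF \<Omega>(2) r bdist_pos[OF \<Omega>(1,3) fin(1)] ball_bdist_subset D(1,3), of N] * le
    by (auto simp: algebra_simps)
  obtain k where k: "k \<le> (real N + 1) * (ln 3 / 2)" "disc_chain \<Omega> c (f z) k"
    using disc_chain_from_ball_center[OF \<Omega>(2) r bdist_pos[OF \<Omega>(1,3) fin(2)] ball_bdist_subset D(2,3), of N] *
    by (auto simp: algebra_simps)
  have "kobayashi_dist \<Omega> (f 0) (f z) \<le> l + k"
    using kobayashi_dist_le disc_chain_trans disc_chain_sym k l by blast
  also have "\<dots> \<le> (real N + 1) * ln 3"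
    using k l by simp
  finally have "artanh (cmod z) \<le> (real N + 1) * ln 3"
    using f z by (simp add: complex_geodesic_def flip: poincare_dist_0)
  \<comment> \<open>Base 16 is chosen for \<open>2 * ln 3 < ln 16\<close>: the distance from 0 to
    \<open>1 - x\<close> is at least \<open>ln (1 / x) / 2\<close>, which exceeds the cost of two
    chains of \<open>N + 1\<close> steps.\<close>
  moreover have "(real N + 1) * ln 3 < artanh (cmod z)"
  proof -
    define x :: real where "x = (1/16) ^ Suc N"
    have x: "0 < x" "x \<le> 1"
      by (auto simp: x_def intro!: power_le_one simp del: power_Suc)
    have "(real N + 1) * ln (3::real) < (real N + 1) * (ln 16 / 2)"
    proof -
      have "2 * ln (3::real) = ln (3 ^ 2)"
        using ln_realpow[of 3 2] by simp
      also have "\<dots> < ln 16"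
        by simp
      finally show ?thesis by (intro mult_strict_left_mono) auto
    qed
    also have "\<dots> = ln (1 / x) / 2"
    proof -
      have "ln (1 / x) = ln (16 ^ Suc N)"
        by (simp add: x_def power_divide)
      also have "\<dots> = real (Suc N) * ln 16"
        by (rule ln_realpow)
      finally show ?thesis by simp
    qed
    also have "\<dots> \<le> ln ((1 + (1 - x)) / (1 - (1 - x))) / 2"
      using x by (intro divide_right_mono ln_mono) (auto simp: field_simps)
    also have "\<dots> = artanh (1 - x)"
      by (simp add: artanh_def)
    also have "\<dots> \<le> artanh (cmod z)"
      using x z by (intro artanh_real_mono) (auto simp: x_def)
    finally show ?thesis .
  qed
  ultimately show False by simp
qed

text \<open>The distance is at most \<open>(x - y) / x\<close>, so neighbouring radii
  \<open>1 - (1/16) ^ k\<close> are uniformly close in the disc.\<close>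

lemma pseudo_hyperbolic_of_real_le:
  assumes "0 < x" "x \<le> 1" "x / 16 \<le> y" "y \<le> x"
  shows "cmod ((of_real (1 - y) - of_real (1 - x)) / (1 - cnj (of_real (1 - y)) * of_real (1 - x))) \<le> 15 / 16"
proof -
  have *: "0 \<le> y * (1 - x)"
    using assms by (intro mult_nonneg_nonneg) auto
  then have den: "x \<le> x + y - x * y"
    by (simp add: algebra_simps)
  have "cmod ((of_real (1 - y) - of_real (1 - x)) / (1 - cnj (of_real (1 - y)) * of_real (1 - x)))
      = cmod (of_real ((x - y) / (x + y - x * y)))"
    by (rule arg_cong[where f = cmod]) (simp add: algebra_simps)
  also have "\<dots> = (x - y) / (x + y - x * y)"
    unfolding norm_of_real using den assms(1,4)
    by (intro abs_of_nonneg divide_nonneg_nonneg) linarith+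
  also have "\<dots> \<le> (x - y) / x"
    using den assms by (intro divide_left_mono mult_pos_pos) linarith+
  also have "\<dots> \<le> 15 / 16"
    using assms by (simp add: field_simps)
  finally show ?thesis .
qed

text \<open>Telescope along the radii \<open>t k\<close> with a last partial step to
  \<open>b\<close>, and sum a geometric series. The factor 30 is
  \<open>2 * \<rho> / (1 - \<rho>)\<close> at \<open>\<rho> = 15/16\<close>.\<close>

lemma norm_diff_le_geometric:
  fixes \<Omega> :: "(complex^'d) set"
  assumes \<Omega>: "open \<Omega>" "convex \<Omega>" "C_proper \<Omega>" and f: "holo_disc f \<Omega>"
    and b: "0 \<le> b" "b < 1" and p: "0 \<le> p" "p < 1" and M: "0 \<le> M"
    and le: "\<And>k v. 1 - (1/16) ^ k \<le> b \<Longrightarrow> v \<noteq> 0 \<Longrightarrow> bdist_dir \<Omega> (f (of_real (1 - (1/16) ^ k))) v \<le> M * p ^ k"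
  shows "norm (f (of_real b) - f 0) \<le> 30 * M / (1 - p)"
proof -
  define t :: "nat \<Rightarrow> real" where "t = (\<lambda>k. 1 - (1/16) ^ k)"
  have step: "norm (f (of_real s) - f (of_real (t k))) \<le> 30 * M * p ^ k" if "t k \<le> s" "s \<le> t (Suc k)" "t k \<le> b" for s k
  proof -
    have x: "0 < (1/16 :: real) ^ k" "(1/16 :: real) ^ k \<le> 1" "0 < (1/16 :: real) ^ Suc k"
      by (auto intro!: power_le_one)
    have *: "norm (f (of_real s) - f (of_real (t k))) \<le> 2 * (15/16) / (1 - 15/16) * (M * p ^ k)"
    proof (rule norm_diff_le_bdist_dir[OF \<Omega> f])
      show "cmod (of_real s) < 1" "cmod (of_real (t k)) < 1"
        unfolding norm_of_real using that x b M by (auto simp: t_def)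
      show "cmod ((of_real s - of_real (t k)) / (1 - cnj (of_real s) * of_real (t k))) \<le> 15/16"
        using pseudo_hyperbolic_of_real_le[of "(1/16) ^ k" "1 - s"] x that by (auto simp: t_def)
      show "bdist_dir \<Omega> (f (of_real (t k))) (f (of_real s) - f (of_real (t k))) \<le> M * p ^ k"
        if "f (of_real s) \<noteq> f (of_real (t k))"
        using le[of k] \<open>t k \<le> b\<close> that by (simp add: t_def)
    qed (use M p in auto)
    then show ?thesis by simp
  qed
  have sum: "norm (f (of_real (t k)) - f 0) \<le> (\<Sum>j<k. 30 * M * p ^ j)" if "t k \<le> b" for k
    using that
  proof (induction k)
    case 0
    then show ?case by (simp add: t_def)
  next
    case (Suc k)
    have "t k \<le> t (Suc k)"
      by (simp add: t_def)
    then have "norm (f (of_real (t k)) - f 0) \<le> (\<Sum>j<k. 30 * M * p ^ j)"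
        "norm (f (of_real (t (Suc k))) - f (of_real (t k))) \<le> 30 * M * p ^ k"
      using Suc.IH Suc.prems step[of k "t (Suc k)"] by auto
    then show ?case
      using norm_triangle_ineq[of "f (of_real (t (Suc k))) - f (of_real (t k))" "f (of_real (t k)) - f 0"] by simp
  qed
  obtain n where "(1/16) ^ n < 1 - b"
    using real_arch_pow_inv[of "1 - b" "1/16"] b by auto
  then have ex: "b < t n" by (simp add: t_def)
  \<comment> \<open>The first radius beyond \<open>b\<close> is not \<open>t 0 = 0\<close>, so it
    has a predecessor \<open>t k \<le> b\<close>, and \<open>b\<close> is within one step of
    it.\<close>
  define n where "n = (LEAST n. b < t n)"
  have n: "b < t n"
    using ex unfolding n_def by (rule LeastI)
  have "n \<noteq> 0"
    using n b by (auto simp: t_def intro!: gr0I)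
  then obtain k where k: "n = Suc k"
    by (cases n) auto
  then have tk: "t k \<le> b"
    using not_less_Least[of k "\<lambda>n. b < t n"] by (simp add: n_def[symmetric])
  have "norm (f (of_real b) - f 0) \<le> 30 * M * p ^ k + (\<Sum>j<k. 30 * M * p ^ j)"
    using norm_triangle_ineq[of "f (of_real b) - f (of_real (t k))" "f (of_real (t k)) - f 0"]
      sum[OF tk] step[of k b] tk n k by simp
  also have "\<dots> = 30 * M * (\<Sum>j<Suc k. p ^ j)"
    by (simp add: distrib_left mult.assoc flip: sum_distrib_left)
  also have "\<dots> \<le> 30 * M * (1 / (1 - p))"
  proof -
    have "(\<Sum>j<Suc k. p ^ j) \<le> (\<Sum>j. p ^ j)"
      using p by (intro sum_le_suminf summable_geometric) auto
    then show ?thesis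
      using p M by (intro mult_left_mono) (auto simp: suminf_geometric)
  qed
  finally show ?thesis by simp
qed

text \<open>At radius \<open>1 - (1/16) ^ k\<close> the boundary distance is at most
  \<open>A * q ^ k\<close> and at most its value at the centre. Combining both bounds through
  \<open>bd\<close> gives directional bounds that are summable in \<open>k\<close> and small with
  the centre value.\<close>

lemma complex_geodesic_displacement:
  fixes \<Omega> :: "(complex^'d) set" and m C r D :: real
  defines "q \<equiv> 1 - r / (2 * D)"
  assumes \<Omega>: "open \<Omega>" "convex \<Omega>" "C_proper \<Omega>" and f: "complex_geodesic \<Omega> f"
    and r: "0 < r" "ball c r \<subseteq> \<Omega>" "r \<le> D"
    and b: "0 \<le> b" "b < 1" and m: "m \<ge> 1" and C: "0 \<le> C"
    and D: "\<And>t. 0 \<le> t \<Longrightarrow> t \<le> b \<Longrightarrow> dist c (f (of_real t)) \<le> D"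
    and le: "\<And>t. 0 \<le> t \<Longrightarrow> t \<le> b \<Longrightarrow> bdist \<Omega> (f (of_real t)) \<le> bdist \<Omega> (f 0)"
    and bd: "\<And>t v. 0 \<le> t \<Longrightarrow> t \<le> b \<Longrightarrow> v \<noteq> 0 \<Longrightarrow>
      bdist_dir \<Omega> (f (of_real t)) v \<le> C * bdist \<Omega> (f (of_real t)) powr (1 / m)"
    and small: "bdist \<Omega> (f 0) \<le> 1"
  shows "norm (f (of_real b) - f 0) \<le> 30 * (C * (max 1 (2 * D / q)) powr (1 / (2 * m)) *
    bdist \<Omega> (f 0) powr (1 / (2 * m))) / (1 - q powr (1 / (2 * m)))"
proof -
  define e where "e = bdist \<Omega> (f 0)"
  \<comment> \<open>The decay at \<open>k = Suc N\<close> has exponent \<open>N\<close>; dividing by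
    \<open>q\<close> shifts it to \<open>k\<close>. The 1 covers \<open>k = 0\<close>, by the
    hypothesis \<open>small\<close>.\<close>
  define A where "A = max 1 (2 * D / q)"
  have D0: "0 < D" using r by simp
  have q: "0 < q" "q < 1"
    using r D0 by (auto simp: q_def field_simps)
  have A: "1 \<le> A" "2 * D / q \<le> A"
    by (auto simp: A_def)
  have f': "holo_disc f \<Omega>"
    using f by (simp add: complex_geodesic_def)
  have decay: "bdist \<Omega> (f (of_real (1 - (1/16) ^ k))) \<le> A * q ^ k" if k: "1 - (1/16) ^ k \<le> b" for k
  proof (cases k)
    case 0
    then show ?thesis using small A by simp
  next
    case (Suc N)
    have x: "0 < (1/16 :: real) ^ k" "(1/16 :: real) ^ k \<le> 1"
      by (auto intro!: power_le_one)
    have "bdist \<Omega> (f (of_real (1 - (1/16) ^ k))) \<le> 2 * D * (1 - r / (2 * D)) ^ N"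
      using x k by (intro complex_geodesic_bdist_decay[OF \<Omega> f r(1,2) _ _ r(3)] D le)
        (use D[of 0] b in \<open>auto simp: Suc simp del: of_real_diff power_Suc\<close>)
    also have "\<dots> = 2 * D / q * q ^ k"
      using q by (simp add: Suc q_def[symmetric])
    also have "\<dots> \<le> A * q ^ k"
      using A q by (intro mult_right_mono) auto
    finally show ?thesis .
  qed
  have "norm (f (of_real b) - f 0) \<le> 30 * (C * A powr (1 / (2 * m)) * e powr (1 / (2 * m))) / (1 - q powr (1 / (2 * m)))"
  proof (rule norm_diff_le_geometric[OF \<Omega> f' b])
    show "0 \<le> q powr (1 / (2 * m))"
      by simp
    show "q powr (1 / (2 * m)) < 1"
      using powr_less_mono2[of "1 / (2 * m)" q 1] q m by simp
    show "0 \<le> C * A powr (1 / (2 * m)) * e powr (1 / (2 * m))"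
      using C by simp
    fix k and v :: "complex^'d" assume k: "1 - (1/16) ^ k \<le> b" and v: "v \<noteq> 0"
    have x: "0 < (1/16 :: real) ^ k" "(1/16 :: real) ^ k \<le> 1"
      by (auto intro!: power_le_one)
    define d where "d = bdist \<Omega> (f (of_real (1 - (1/16) ^ k)))"
    have d: "0 \<le> d" "d \<le> e" "d \<le> A * q ^ k"
      using le[of "1 - (1/16) ^ k"] decay[OF k] x k by (auto simp: d_def e_def bdist_def infdist_nonneg)
    have "bdist_dir \<Omega> (f (of_real (1 - (1/16) ^ k))) v \<le> C * d powr (1 / m)"
      using bd[of "1 - (1/16) ^ k" v] x k v by (simp add: d_def)
    \<comment> \<open>Half of the exponent pays for the smallness of \<open>e\<close>, the other half for summability over \<open>k\<close>.\<close>
    also have "d powr (1 / m) = d powr (1 / (2 * m)) * d powr (1 / (2 * m))"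
      by (simp flip: powr_add)
    also have "\<dots> \<le> (A * q ^ k) powr (1 / (2 * m)) * e powr (1 / (2 * m))"
      using d m by (intro mult_mono powr_mono2) auto
    finally have "bdist_dir \<Omega> (f (of_real (1 - (1/16) ^ k))) v \<le>
        C * ((A * q ^ k) powr (1 / (2 * m)) * e powr (1 / (2 * m)))"
      using C by (simp add: mult_left_mono)
    also have "(A * q ^ k) powr (1 / (2 * m)) = A powr (1 / (2 * m)) * (q powr (1 / (2 * m))) ^ k"
      using A q by (simp add: powr_mult powr_powr mult.commute flip: powr_realpow)
    finally show "bdist_dir \<Omega> (f (of_real (1 - (1/16) ^ k))) v \<le>
        C * A powr (1 / (2 * m)) * e powr (1 / (2 * m)) * (q powr (1 / (2 * m))) ^ k"
      by (simp add: mult_ac)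
  qed
  then show ?thesis
    by (simp add: A_def e_def)
qed

text \<open>Turns the part of a geodesic over \<open>[a, 0]\<close> into one over
  \<open>[0, - a]\<close>, where the displacement bound applies.\<close>

lemma complex_geodesic_reflect:
  assumes "complex_geodesic \<Omega> f"
  shows "complex_geodesic \<Omega> (\<lambda>z. f (- z))"
proof -
  have "(\<lambda>z. f (- z) $ i) holomorphic_on ball 0 1" for i
    using assms holomorphic_on_compose_gen[of "\<lambda>z. - z" "ball 0 1" "\<lambda>z. f z $ i" "ball 0 1"]
      holomorphic_on_minus[OF holomorphic_on_ident]
    by (auto simp: complex_geodesic_def holo_disc_def o_def image_subset_iff)
  then show ?thesis
    using assms by (auto simp: complex_geodesic_def holo_disc_def poincare_dist_minus)
qed

section \<open>Convergence of domains and of discs\<close>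

text \<open>Convexity turns Hausdorff closeness into inclusion. If \<open>y\<close> in
  \<open>K\<close> were outside \<open>\<Omega>s n\<close>, the point \<open>w\<close>, pushed by
  \<open>e / 2\<close> along the normal of a separating hyperplane, would lie in
  \<open>\<Omega>\<close> but at least \<open>e / 2\<close> away from the closure of
  \<open>\<Omega>s n\<close>.\<close>

lemma eventually_compact_subset_of_local_hausdorff_conv:
  fixes \<Omega> :: "(complex^'d) set"
  assumes conv: "local_hausdorff_conv \<Omega>s \<Omega>" and \<Omega>s: "\<And>n. open (\<Omega>s n)" "\<And>n. convex (\<Omega>s n)"
    and K: "compact K" "K \<subseteq> \<Omega>" and \<Omega>: "open \<Omega>"
  shows "\<forall>\<^sub>F n in sequentially. K \<subseteq> \<Omega>s n"
proof -
  obtain e where e: "0 < e" "(\<Union>x\<in>K. ball x e) \<subseteq> \<Omega>"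
    using compact_subset_open_imp_ball_epsilon_subset[OF K(1) \<Omega> K(2)] by blast
  obtain B where B: "0 < B" "\<And>x. x \<in> K \<Longrightarrow> norm x \<le> B"
    using compact_imp_bounded[OF K(1)] by (meson bounded_pos)
  have "\<forall>\<^sub>F n in sequentially. \<forall>y\<in>closure \<Omega> \<inter> cball 0 (B + e). \<exists>x\<in>closure (\<Omega>s n) \<inter> cball 0 (B + e). dist x y < e / 4"
    using conv[unfolded local_hausdorff_conv_def, rule_format, of "B + e" "e / 4"] e B
    by (auto elim: eventually_mono)
  then show ?thesis
  proof eventually_elim
    case (elim n)
    show ?case
    proof (rule subsetI, rule ccontr)
      fix y assume y: "y \<in> K" "y \<notin> \<Omega>s n"
      obtain u where u: "norm u = 1" "\<And>x. x \<in> \<Omega>s n \<Longrightarrow> 0 < Re (cform u (y - x))"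
        using separating_cform[of "\<Omega>s n" y] \<Omega>s y by blast
      have "closure (\<Omega>s n) \<subseteq> {x. inner u x \<le> inner u y}"
        using u(2) by (intro closure_minimal closed_halfspace_le) (force simp: Re_cform inner_diff_right)
      moreover define w where "w = y + (e / 2) *\<^sub>R u"
      have "w \<in> ball y e"
        using e u(1) by (simp add: w_def dist_norm)
      then have "w \<in> \<Omega>"
        using e y by blast
      moreover have "norm w \<le> B + e"
        using B(2)[OF y(1)] norm_triangle_ineq[of y "(e / 2) *\<^sub>R u"] u(1) e(1) by (simp add: w_def)
      ultimately obtain x where x: "inner u x \<le> inner u y" "dist x w < e / 4"
        using elim closure_subset[of \<Omega>] by fastforce
      have "inner u (w - x) \<le> norm (w - x)"
        using norm_cauchy_schwarz[of u "w - x"] u(1) by simp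
      moreover have "inner u w = inner u y + e / 2"
        using u(1) by (simp add: w_def inner_add_right dot_square_norm)
      ultimately show False
        using x e(1) by (simp add: inner_diff_right dist_norm norm_minus_commute)
    qed
  qed
qed

lemma local_hausdorff_convD:
  assumes "local_hausdorff_conv \<Omega>s \<Omega>" "0 < R" "0 < e"
  shows "\<forall>\<^sub>F n in sequentially. \<forall>x\<in>closure (\<Omega>s n) \<inter> cball 0 R. \<exists>y\<in>closure \<Omega>. dist x y < e"
proof -
  have "\<forall>\<^sub>F n in sequentially.
      (\<forall>x\<in>closure (\<Omega>s n) \<inter> cball 0 R. \<exists>y\<in>closure \<Omega> \<inter> cball 0 R. dist x y < e) \<and>
      (\<forall>y\<in>closure \<Omega> \<inter> cball 0 R. \<exists>x\<in>closure (\<Omega>s n) \<inter> cball 0 R. dist x y < e)"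
    using assms unfolding local_hausdorff_conv_def by blast
  then show ?thesis
    by (rule eventually_mono) blast
qed

lemma local_hausdorff_conv_lim_in_closure:
  assumes conv: "local_hausdorff_conv \<Omega>s \<Omega>" and r: "strict_mono r"
    and x: "x \<longlonglongrightarrow> l" "\<forall>\<^sub>F n in sequentially. x n \<in> \<Omega>s (r n)"
  shows "l \<in> closure \<Omega>"
proof -
  have "\<exists>y\<in>closure \<Omega>. dist y l < e" if e: "0 < e" for e
  proof -
    have "\<forall>\<^sub>F n in sequentially. \<forall>x\<in>closure (\<Omega>s (r n)) \<inter> cball 0 (norm l + 1). \<exists>y\<in>closure \<Omega>. dist x y < e / 2"
      using eventually_subseq[OF r local_hausdorff_convD[OF conv, of "norm l + 1" "e / 2"]] e
      by (simp add: add_nonneg_pos)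
    moreover have "\<forall>\<^sub>F n in sequentially. dist (x n) l < min 1 (e / 2)"
      using e by (intro tendstoD[OF x(1)]) auto
    ultimately have "\<forall>\<^sub>F n in sequentially. \<exists>y\<in>closure \<Omega>. dist y l < e"
      using x(2)
    proof eventually_elim
      case (elim n)
      have "norm (x n) \<le> norm l + 1"
        using elim(2) norm_triangle_ineq[of "x n - l" l] by (simp add: dist_norm)
      moreover have "x n \<in> closure (\<Omega>s (r n))"
        using elim(3) closure_subset by blast
      ultimately obtain y where "y \<in> closure \<Omega>" "dist (x n) y < e / 2"
        using bspec[OF elim(1), of "x n"] by auto
      moreover have "dist y l \<le> dist (x n) y + dist (x n) l"
        by (metis dist_commute dist_triangle)
      ultimately show ?case
        using elim(2) by (intro bexI[of _ y]) auto
    qed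
    then show ?thesis
      by (simp)
  qed
  then show ?thesis
    using closure_approachable[of l "closure \<Omega>"] by auto
qed

text \<open>Each point of a small ball around \<open>l\<close> lies in all late domains of the
  subsequence, so the ball lies in the closure of \<open>\<Omega>\<close>; an open convex set is the
  interior of its closure.\<close>

lemma local_hausdorff_conv_lim_in:
  fixes \<Omega> :: "(complex^'d) set"
  assumes conv: "local_hausdorff_conv \<Omega>s \<Omega>" and \<Omega>: "open \<Omega>" "convex \<Omega>" and r: "strict_mono r"
    and x: "x \<longlonglongrightarrow> l" and c: "0 < c" "\<forall>\<^sub>F n in sequentially. c \<le> bdist (\<Omega>s (r n)) (x n)"
  shows "l \<in> \<Omega>"
proof -
  have "ball l (c / 2) \<subseteq> closure \<Omega>"
  proof
    fix y assume y: "y \<in> ball l (c / 2)"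
    have "\<forall>\<^sub>F n in sequentially. dist (x n) l < c / 2"
      using c by (intro tendstoD[OF x]) auto
    with c(2) have "\<forall>\<^sub>F n in sequentially. y \<in> \<Omega>s (r n)"
    proof eventually_elim
      case (elim n)
      have "dist (x n) y \<le> dist (x n) l + dist l y"
        by (rule dist_triangle)
      then have "y \<in> ball (x n) (bdist (\<Omega>s (r n)) (x n))"
        using elim y by simp
      then show ?case
        using ball_bdist_subset by blast
    qed
    then show "y \<in> closure \<Omega>"
      by (rule local_hausdorff_conv_lim_in_closure[OF conv r tendsto_const])
  qed
  then have "l \<in> interior (closure \<Omega>)"
    using c by (meson centre_in_ball half_gt_zero interior_maximal open_ball subsetD)
  then show ?thesis
    using \<Omega> by (simp add: convex_interior_closure interior_open)
qed

text \<open>A point outside the closure of \<open>\<Omega>\<close> stays outside all late domains.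
  It exists because an open convex set with nonempty complement is not dense.\<close>

lemma eventually_bdist_le_of_local_hausdorff_conv:
  fixes \<Omega> :: "(complex^'d) set"
  assumes conv: "local_hausdorff_conv \<Omega>s \<Omega>" and \<Omega>: "open \<Omega>" "convex \<Omega>" "C_proper \<Omega>"
  obtains B where "\<forall>\<^sub>F n in sequentially. \<forall>p\<in>cball 0 R. bdist (\<Omega>s n) p \<le> B"
proof -
  have "closure \<Omega> \<noteq> UNIV"
    using convex_interior_closure[OF \<Omega>(2)] C_proper_not_UNIV[OF \<Omega>(3)] \<Omega>(1) by (auto simp: interior_open)
  then obtain \<xi> where \<xi>: "\<xi> \<notin> closure \<Omega>" by blast
  then obtain e where e: "0 < e" "\<And>y. y \<in> closure \<Omega> \<Longrightarrow> e \<le> dist y \<xi>"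
    using closure_approachable[of \<xi> "closure \<Omega>"] by (auto simp: not_less)
  have "\<forall>\<^sub>F n in sequentially. \<forall>x\<in>closure (\<Omega>s n) \<inter> cball 0 (norm \<xi> + 1). \<exists>y\<in>closure \<Omega>. dist x y < e"
    using e by (intro local_hausdorff_convD[OF conv]) (simp_all add: add_nonneg_pos)
  then have "\<forall>\<^sub>F n in sequentially. \<forall>p\<in>cball 0 R. bdist (\<Omega>s n) p \<le> R + norm \<xi>"
  proof eventually_elim
    case (elim n)
    have "\<xi> \<notin> closure (\<Omega>s n)"
    proof
      assume "\<xi> \<in> closure (\<Omega>s n)"
      then obtain y where "y \<in> closure \<Omega>" "dist \<xi> y < e"
        using bspec[OF elim, of \<xi>] by auto
      then show False
        using e(2)[of y] by (simp add: dist_commute)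
    qed
    then have "\<xi> \<notin> \<Omega>s n"
      using closure_subset by blast
    show ?case
    proof
      fix p :: "complex^'d" assume "p \<in> cball 0 R"
      then have "dist p \<xi> \<le> R + norm \<xi>"
        using norm_triangle_ineq4[of p \<xi>] by (simp add: dist_norm)
      then show "bdist (\<Omega>s n) p \<le> R + norm \<xi>"
        unfolding bdist_def using \<open>\<xi> \<notin> \<Omega>s n\<close> by (intro infdist_le2[of \<xi>]) auto
    qed
  qed
  then show ?thesis
    using that by blast
qed

text \<open>Scalar Montel is applied to one coordinate at a time; passing to a further subsequence
  keeps the limits already found.\<close>

lemma Montel_vector:
  fixes F :: "nat \<Rightarrow> complex \<Rightarrow> complex^'d"
  assumes S: "open S" and holo: "\<And>n i. (\<lambda>z. F n z $ i) holomorphic_on S"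
    and bound: "\<And>K. compact K \<Longrightarrow> K \<subseteq> S \<Longrightarrow> \<exists>B. \<forall>n. \<forall>z\<in>K. norm (F n z) \<le> B"
  obtains g r where "strict_mono r" "\<And>i. (\<lambda>z. g z $ i) holomorphic_on S"
    "\<And>K. compact K \<Longrightarrow> K \<subseteq> S \<Longrightarrow> uniform_limit K (\<lambda>n. F (r n)) g sequentially"
proof -
  have "\<exists>r :: nat \<Rightarrow> nat. strict_mono r \<and> (\<forall>i\<in>I. \<exists>g. g holomorphic_on S \<and>
      (\<forall>K. compact K \<and> K \<subseteq> S \<longrightarrow> uniform_limit K (\<lambda>n z. F (r n) z $ i) g sequentially))" for I :: "'d set"
  proof (induction I rule: finite_induct[OF finite])
    case 1
    then show ?case
      by (intro exI[of _ id]) (auto simp: strict_mono_def)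
  next
    case (2 i I)
    then obtain r where r: "strict_mono (r :: nat \<Rightarrow> nat)" "\<And>i. i \<in> I \<Longrightarrow> \<exists>g. g holomorphic_on S \<and>
      (\<forall>K. compact K \<and> K \<subseteq> S \<longrightarrow> uniform_limit K (\<lambda>n z. F (r n) z $ i) g sequentially)"
      by blast
    obtain g s where g: "g holomorphic_on S" "strict_mono (s :: nat \<Rightarrow> nat)"
      "\<And>K. compact K \<Longrightarrow> K \<subseteq> S \<Longrightarrow> uniform_limit K ((\<lambda>n z. F (r n) z $ i) \<circ> s) g sequentially"
    proof (rule Montel[OF S, of "range (\<lambda>n z. F (r n) z $ i)" "\<lambda>n z. F (r n) z $ i"])
      fix K assume "compact K" "K \<subseteq> S"
      from bound[OF this] obtain B where B: "\<And>n z. z \<in> K \<Longrightarrow> norm (F n z) \<le> B"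
        by blast
      show "\<exists>B. \<forall>h\<in>range (\<lambda>n z. F (r n) z $ i). \<forall>z\<in>K. cmod (h z) \<le> B"
        using order_trans[OF Finite_Cartesian_Product.norm_nth_le B] by (intro exI[of _ B]) auto
    qed (use holo in auto)
    have sub: "uniform_limit K (\<lambda>n z. F ((r \<circ> s) n) z $ j) h sequentially"
      if "uniform_limit K (\<lambda>n z. F (r n) z $ j) h sequentially" for j h K
      using filterlim_compose[OF that filterlim_subseq[OF g(2)]] by (simp add: o_def)
    have "\<exists>g. g holomorphic_on S \<and>
      (\<forall>K. compact K \<and> K \<subseteq> S \<longrightarrow> uniform_limit K (\<lambda>n z. F ((r \<circ> s) n) z $ j) g sequentially)" if j: "j \<in> insert i I" for j
    proof (cases "j = i")
      case True
      then show ?thesis using g by (intro exI[of _ g]) (auto simp: o_def)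
    next
      case False
      then obtain h where "h holomorphic_on S"
          "\<And>K. compact K \<Longrightarrow> K \<subseteq> S \<Longrightarrow> uniform_limit K (\<lambda>n z. F (r n) z $ j) h sequentially"
        using r(2)[of j] j False by auto
      then show ?thesis
        using sub by (intro exI[of _ h]) blast
    qed
    then show ?case
      using strict_mono_o[OF r(1) g(2)] by blast
  qed
  from this[of UNIV] obtain r where r: "strict_mono (r :: nat \<Rightarrow> nat)"
    and ex: "\<forall>i. \<exists>g. g holomorphic_on S \<and>
      (\<forall>K. compact K \<and> K \<subseteq> S \<longrightarrow> uniform_limit K (\<lambda>n z. F (r n) z $ i) g sequentially)"
    by auto
  from choice[OF ex] obtain g where g: "\<And>i. g i holomorphic_on S"
      "\<And>i K. compact K \<Longrightarrow> K \<subseteq> S \<Longrightarrow> uniform_limit K (\<lambda>n z. F (r n) z $ i) (g i) sequentially"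
    by blast
  define G where "G = (\<lambda>z. \<chi> i. g i z)"
  have "uniform_limit K (\<lambda>n. F (r n)) G sequentially" if K: "compact K" "K \<subseteq> S" for K
  proof (rule uniform_limitI)
    fix e :: real assume e: "0 < e"
    have "\<forall>\<^sub>F n in sequentially. \<forall>i. \<forall>z\<in>K. dist (F (r n) z $ i) (g i z) < e / CARD('d)"
      using g(2)[OF K] e by (intro eventually_all_finite) (auto simp: uniform_limit_iff)
    then show "\<forall>\<^sub>F n in sequentially. \<forall>z\<in>K. dist (F (r n) z) (G z) < e"
    proof eventually_elim
      case (elim n)
      show ?case
      proof
        fix z assume z: "z \<in> K"
        have "dist (F (r n) z) (G z) \<le> (\<Sum>i\<in>UNIV. dist (F (r n) z $ i) (g i z))"
          unfolding dist_vec_def G_def by (simp add: L2_set_le_sum)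
        also have "\<dots> < (\<Sum>i\<in>(UNIV :: 'd set). e / CARD('d))"
          using elim z by (intro sum_strict_mono) auto
        finally show "dist (F (r n) z) (G z) < e"
          by simp
      qed
    qed
  qed
  then show ?thesis
    using that[OF r, of G] g(1) by (simp add: G_def)
qed

section \<open>Limits of geodesics\<close>

text \<open>The upper bound is \<open>g\<close> as a chain of one disc. For the lower bound, a chain
  in \<open>\<Omega>\<close> is carried to late domains at extra cost \<open>e / 3\<close>, and its
  ends are joined to points of the converging geodesics, whose distance is exactly
  \<open>poincare_dist p q\<close>, at cost \<open>e / 3\<close> each.\<close>

lemma complex_geodesic_lim:
  fixes \<Omega> :: "(complex^'d) set"
  assumes conv: "local_hausdorff_conv \<Omega>s \<Omega>" and \<Omega>s: "\<And>n. open (\<Omega>s n)" "\<And>n. convex (\<Omega>s n)" and \<Omega>: "open \<Omega>"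
    and geod: "\<And>n. complex_geodesic (\<Omega>s n) (\<phi>s n)" and r: "strict_mono r"
    and g: "holo_disc g \<Omega>" and lim: "\<And>z. cmod z < 1 \<Longrightarrow> (\<lambda>k. \<phi>s (r k) z) \<longlonglongrightarrow> g z"
  shows "complex_geodesic \<Omega> g"
  unfolding complex_geodesic_def
proof (intro conjI ballI antisym)
  fix p q :: complex assume "p \<in> ball 0 1" "q \<in> ball 0 1"
  then have pq: "cmod p < 1" "cmod q < 1" by auto
  have chain: "disc_chain \<Omega> (g p) (g q) (poincare_dist p q)"
    using disc_chain.disc[OF g pq] .
  then show "kobayashi_dist \<Omega> (g p) (g q) \<le> poincare_dist p q"
    by (rule kobayashi_dist_le)
  \<comment> \<open>A fixed ball around \<open>g z\<close> lies in all late domains, so one short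
    affine disc reaches nearby points.\<close>
  have short: "\<forall>\<^sub>F k in sequentially. \<exists>l\<le>e. disc_chain (\<Omega>s (r k)) (g z) (\<phi>s (r k) z) l"
    if z: "cmod z < 1" and e: "0 < e" for z and e :: real
  proof -
    have "g z \<in> \<Omega>"
      using g z by (auto simp: holo_disc_def)
    then obtain \<rho> where \<rho>: "0 < \<rho>" "cball (g z) \<rho> \<subseteq> \<Omega>"
      using \<Omega> open_contains_cball by blast
    have dist0: "(\<lambda>k. dist (g z) (\<phi>s (r k) z)) \<longlonglongrightarrow> 0"
      using tendsto_dist[OF tendsto_const lim[OF z], of "g z"] by simp
    have "(\<lambda>k. artanh (dist (g z) (\<phi>s (r k) z) / \<rho>)) \<longlonglongrightarrow> artanh (0 / \<rho>)"
      using \<rho>(1) by (intro tendsto_artanh tendsto_divide dist0 tendsto_const) auto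
    then have "\<forall>\<^sub>F k in sequentially. artanh (dist (g z) (\<phi>s (r k) z) / \<rho>) < e"
      using e by (intro order_tendstoD(2)) auto
    moreover have "\<forall>\<^sub>F k in sequentially. dist (g z) (\<phi>s (r k) z) < \<rho>"
      using \<rho>(1) by (intro order_tendstoD(2)[OF dist0]) auto
    moreover have "\<forall>\<^sub>F k in sequentially. cball (g z) \<rho> \<subseteq> \<Omega>s (r k)"
      using eventually_compact_subset_of_local_hausdorff_conv[OF conv \<Omega>s _ \<rho>(2) \<Omega>]
      by (intro eventually_subseq[OF r, of "\<lambda>n. cball (g z) \<rho> \<subseteq> \<Omega>s n"]) auto
    ultimately show ?thesis
    proof eventually_elim
      case (elim k)
      then have "ball (g z) \<rho> \<subseteq> \<Omega>s (r k)"
        using ball_subset_cball by blast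
      from disc_chain_ball[OF this elim(2)] elim(1) show ?case
        by (meson less_imp_le)
    qed
  qed
  have "poincare_dist p q \<le> l" if l: "disc_chain \<Omega> (g p) (g q) l" for l
  proof (rule field_le_epsilon)
    fix e :: real assume "0 < e"
    then have e: "0 < e / 3" by simp
    obtain K where K: "compact K" "K \<subseteq> \<Omega>" "\<And>\<Omega>'. K \<subseteq> \<Omega>' \<Longrightarrow> \<exists>l'\<le>l + e / 3. disc_chain \<Omega>' (g p) (g q) l'"
      using disc_chain_transfer[OF l e] by blast
    have "\<forall>\<^sub>F k in sequentially. K \<subseteq> \<Omega>s (r k)"
      using eventually_compact_subset_of_local_hausdorff_conv[OF conv \<Omega>s K(1,2) \<Omega>]
      by (intro eventually_subseq[OF r, of "\<lambda>n. K \<subseteq> \<Omega>s n"]) auto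
    then have "\<forall>\<^sub>F k in sequentially. poincare_dist p q \<le> l + e"
      using short[OF pq(1) e] short[OF pq(2) e]
    proof eventually_elim
      case (elim k)
      obtain a b c where a: "a \<le> e / 3" "disc_chain (\<Omega>s (r k)) (g p) (\<phi>s (r k) p) a"
        and b: "b \<le> e / 3" "disc_chain (\<Omega>s (r k)) (g q) (\<phi>s (r k) q) b"
        and c: "c \<le> l + e / 3" "disc_chain (\<Omega>s (r k)) (g p) (g q) c"
        using elim(2,3) K(3)[OF elim(1)] by blast
      have "disc_chain (\<Omega>s (r k)) (\<phi>s (r k) p) (\<phi>s (r k) q) (a + (c + b))"
        using disc_chain_trans[OF disc_chain_trans[OF b(2) c(2)] disc_chain_sym[OF a(2)]] .
      then have "kobayashi_dist (\<Omega>s (r k)) (\<phi>s (r k) p) (\<phi>s (r k) q) \<le> a + (c + b)"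
        by (rule kobayashi_dist_le)
      then show ?case
        using a b c geod[of "r k"] pq by (simp add: complex_geodesic_def)
    qed
    then show "poincare_dist p q \<le> l + e"
      by simp
  qed
  then show "poincare_dist p q \<le> kobayashi_dist \<Omega> (g p) (g q)"
    unfolding kobayashi_dist_eq_Inf_disc_chain using chain by (intro cInf_greatest) auto
qed (rule g)

text \<open>The displacement bound on both sides of the centre controls the distance of the end
  points by a power of the centre's boundary distance, which therefore cannot tend to 0.\<close>

lemma eventually_bdist_centre_ge:
  fixes \<Omega> :: "(complex^'d) set"
  assumes m: "m \<ge> 1" and mconv: "locally_m_convex_seq m \<Omega>s"
    and \<Omega>s: "\<And>n. open (\<Omega>s n)" "\<And>n. convex (\<Omega>s n)" "\<And>n. C_proper (\<Omega>s n)"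
    and \<Omega>: "open \<Omega>" and conv: "local_hausdorff_conv \<Omega>s \<Omega>"
    and geod: "\<And>n. complex_geodesic (\<Omega>s n) (\<phi>s n)" and R: "0 < R"
    and ab: "\<And>n. -1 < a n \<and> a n \<le> 0 \<and> 0 \<le> b n \<and> b n < 1"
    and sub: "\<And>n t. a n \<le> t \<Longrightarrow> t \<le> b n \<Longrightarrow> norm (\<phi>s n (of_real t)) < R"
    and L: "0 < L" "(\<lambda>n. norm (\<phi>s n (of_real (a n)) - \<phi>s n (of_real (b n)))) \<longlonglongrightarrow> L"
    and max: "\<And>n t. a n \<le> t \<Longrightarrow> t \<le> b n \<Longrightarrow> bdist (\<Omega>s n) (\<phi>s n (of_real t)) \<le> bdist (\<Omega>s n) (\<phi>s n 0)"
  obtains c where "0 < c" "\<forall>\<^sub>F n in sequentially. c \<le> bdist (\<Omega>s n) (\<phi>s n 0)"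
proof -
  have in_\<Omega>s: "\<phi>s n (of_real t) \<in> \<Omega>s n" if "a n \<le> t" "t \<le> b n" for n t
    using geod[of n] ab[of n] that by (auto simp: complex_geodesic_def holo_disc_def)
  \<comment> \<open>The centres stay in a fixed ball, so Hausdorff convergence yields a point of the
    closure of \<open>\<Omega>\<close>.\<close>
  have "\<Omega> \<noteq> {}"
  proof -
    obtain n where n: "\<forall>x\<in>closure (\<Omega>s n) \<inter> cball 0 R. \<exists>y\<in>closure \<Omega>. dist x y < 1"
      using eventually_happens'[OF sequentially_bot local_hausdorff_convD[OF conv R zero_less_one]] by blast
    have "\<phi>s n (of_real 0) \<in> closure (\<Omega>s n) \<inter> cball 0 R"
      using in_\<Omega>s[of n 0] sub[of n 0] ab[of n] closure_subset[of "\<Omega>s n"] by auto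
    from bspec[OF n this] show ?thesis by auto
  qed
  then obtain c r where r: "0 < r" "cball c r \<subseteq> \<Omega>"
    using \<Omega> open_contains_cball by blast
  obtain N C where C: "0 < C" "\<And>n p v. N < n \<Longrightarrow> p \<in> \<Omega>s n \<inter> ball 0 R \<Longrightarrow> v \<noteq> 0 \<Longrightarrow>
      bdist_dir (\<Omega>s n) p v \<le> C * bdist (\<Omega>s n) p powr (1 / m)"
    using mconv R unfolding locally_m_convex_seq_def by meson
  define D where "D = R + norm c + r"
  define q where "q = 1 - r / (2 * D)"
  define \<alpha> where "\<alpha> = 1 / (2 * m)"
  define H where "H = 30 * (C * (max 1 (2 * D / q)) powr \<alpha>) / (1 - q powr \<alpha>)"
  \<comment> \<open>Chosen for \<open>H * k \<le> L / 4\<close>, so the two displacements add up to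
    at most \<open>L / 2\<close>; the summand 4 keeps the denominator positive when
    \<open>H = 0\<close>.\<close>
  define k where "k = L / (4 * H + 4)"
  have D: "r \<le> D" "0 < D"
    using R r by (auto simp: D_def add_pos_nonneg)
  have q: "0 < q" "q < 1"
    using r D by (auto simp: q_def field_simps)
  have \<alpha>: "0 < \<alpha>"
    using m by (simp add: \<alpha>_def)
  have "q powr \<alpha> < 1"
    using powr_less_mono2[OF \<alpha>, of q 1] q by simp
  then have H: "0 \<le> H"
    using C by (simp add: H_def)
  have k: "0 < k"
    using H L by (simp add: k_def)
  have "\<forall>\<^sub>F n in sequentially. cball c r \<subseteq> \<Omega>s n"
    using r by (intro eventually_compact_subset_of_local_hausdorff_conv[OF conv \<Omega>s(1,2) _ _ \<Omega>]) auto
  moreover have "\<forall>\<^sub>F n in sequentially. L / 2 < norm (\<phi>s n (of_real (a n)) - \<phi>s n (of_real (b n)))"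
    using L by (intro order_tendstoD(1)[OF L(2)]) auto
  \<comment> \<open>The minimum with 1 secures the hypothesis \<open>small\<close> of the
    displacement lemma.\<close>
  ultimately have "\<forall>\<^sub>F n in sequentially. min 1 (k powr (1 / \<alpha>)) \<le> bdist (\<Omega>s n) (\<phi>s n 0)"
    using eventually_gt_at_top[of N]
  proof eventually_elim
    case (elim n)
    show ?case
    proof (rule ccontr)
      define e where "e = bdist (\<Omega>s n) (\<phi>s n 0)"
      assume "\<not> ?thesis"
      then have e: "e \<le> 1" "e \<le> k powr (1 / \<alpha>)"
        by (auto simp: e_def)
      have e0: "0 \<le> e"
        by (simp add: e_def bdist_def infdist_nonneg)
      have cr: "ball c r \<subseteq> \<Omega>s n"
        using elim(1) ball_subset_cball by blast
      \<comment> \<open>Stated for any geodesic \<open>f\<close> so that it serves both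
        \<open>\<phi>s n\<close> and its reflection; \<open>orig\<close> places the values of
        \<open>f\<close> among those of \<open>\<phi>s n\<close> on
        \<open>[a n, b n]\<close>.\<close>
      have est: "norm (f (of_real s) - f 0) \<le> H * e powr \<alpha>"
        if f: "complex_geodesic (\<Omega>s n) f" "f 0 = \<phi>s n 0" and s: "0 \<le> s" "s < 1"
          and orig: "\<And>t. 0 \<le> t \<Longrightarrow> t \<le> s \<Longrightarrow> \<exists>t'. a n \<le> t' \<and> t' \<le> b n \<and> f (of_real t) = \<phi>s n (of_real t')" for f s
      proof -
        have "norm (f (of_real s) - f 0) \<le> 30 * (C * (max 1 (2 * D / (1 - r / (2 * D)))) powr (1 / (2 * m)) *
          bdist (\<Omega>s n) (f 0) powr (1 / (2 * m))) / (1 - (1 - r / (2 * D)) powr (1 / (2 * m)))"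
        proof (rule complex_geodesic_displacement[OF \<Omega>s(1-3) f(1) r(1) cr D(1) s m])
          show "bdist (\<Omega>s n) (f 0) \<le> 1" "0 \<le> C"
            using e C f(2) by (auto simp: e_def)
          fix t assume "0 \<le> t" "t \<le> s"
          from orig[OF this] obtain t' where t': "a n \<le> t'" "t' \<le> b n" "f (of_real t) = \<phi>s n (of_real t')"
            by blast
          show "dist c (f (of_real t)) \<le> D"
            using sub[OF t'(1,2)] r(1) norm_triangle_ineq4[of c "\<phi>s n (of_real t')"] by (simp add: t'(3) dist_norm D_def)
          show "bdist (\<Omega>s n) (f (of_real t)) \<le> bdist (\<Omega>s n) (f 0)"
            using max[OF t'(1,2)] by (simp add: t'(3) f(2))
          fix v :: "complex^'d" assume "v \<noteq> 0"
          then show "bdist_dir (\<Omega>s n) (f (of_real t)) v \<le> C * bdist (\<Omega>s n) (f (of_real t)) powr (1 / m)"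
            using C(2)[OF elim(3)] in_\<Omega>s[OF t'(1,2)] sub[OF t'(1,2)] by (simp add: t'(3))
        qed
        then show ?thesis
          by (simp add: H_def e_def f(2) \<alpha>_def q_def)
      qed
      have "norm (\<phi>s n (of_real (b n)) - \<phi>s n 0) \<le> H * e powr \<alpha>"
        using ab[of n] by (intro est[OF geod]) (auto intro: order_trans)
      moreover have "norm (\<phi>s n (- of_real (- a n)) - \<phi>s n (- 0)) \<le> H * e powr \<alpha>"
      proof (rule est[OF complex_geodesic_reflect[OF geod]])
        fix t assume "0 \<le> t" "t \<le> - a n"
        then show "\<exists>t'. a n \<le> t' \<and> t' \<le> b n \<and> \<phi>s n (- of_real t) = \<phi>s n (of_real t')"
          using ab[of n] by (intro exI[of _ "- t"]) auto
      qed (use ab[of n] in auto)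
      moreover have "H * e powr \<alpha> \<le> H * k"
      proof -
        have "e powr \<alpha> \<le> (k powr (1 / \<alpha>)) powr \<alpha>"
          using e e0 \<alpha> by (intro powr_mono2) auto
        also have "\<dots> = k"
          using \<alpha> k by (simp add: powr_powr)
        finally show ?thesis
          using H by (rule mult_left_mono)
      qed
      moreover have "H * k \<le> L / 4"
        using H L by (simp add: k_def field_simps)
      moreover have "norm (\<phi>s n (of_real (a n)) - \<phi>s n (of_real (b n))) \<le>
          norm (\<phi>s n (of_real (a n)) - \<phi>s n 0) + norm (\<phi>s n (of_real (b n)) - \<phi>s n 0)"
        using norm_triangle_ineq4[of "\<phi>s n (of_real (a n)) - \<phi>s n 0" "\<phi>s n (of_real (b n)) - \<phi>s n 0"] by simp
      ultimately show False
        using elim(2) by simp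
    qed
  qed
  moreover have "0 < min 1 (k powr (1 / \<alpha>))"
    using k by simp
  ultimately show ?thesis
    using that by blast
qed

theorem theorem7p4:
  fixes \<Omega>s :: "nat \<Rightarrow> (complex^'d) set" and \<Omega> :: "(complex^'d) set"
    and \<phi>s :: "nat \<Rightarrow> complex \<Rightarrow> complex^'d"
    and m R :: real and a b :: "nat \<Rightarrow> real"
  assumes "m \<ge> 1"
    and "locally_m_convex_seq m \<Omega>s"
    and "\<And>n. open (\<Omega>s n) \<and> convex (\<Omega>s n) \<and> C_proper (\<Omega>s n)"
    and "open \<Omega>" and "convex \<Omega>" and "C_proper \<Omega>"
    and "local_hausdorff_conv \<Omega>s \<Omega>"
    and "\<And>n. complex_geodesic (\<Omega>s n) (\<phi>s n)"
    and "R > 0"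
    and "\<And>n. a n \<in> {-1<..<1} \<and> b n \<in> {-1<..<1}"
    and "\<And>n. a n \<le> 0 \<and> 0 \<le> b n"
    and "\<And>n. \<phi>s n ` (complex_of_real ` {a n..b n}) \<subseteq> ball 0 R"
    and "\<exists>L>0. (\<lambda>n. norm (\<phi>s n (complex_of_real (a n)) - \<phi>s n (complex_of_real (b n)))) \<longlonglongrightarrow> L"
    and "\<And>n. \<forall>t\<in>{a n..b n}. bdist (\<Omega>s n) (\<phi>s n (complex_of_real t)) \<le> bdist (\<Omega>s n) (\<phi>s n 0)"
  shows "\<exists>r \<phi>. strict_mono r \<and> complex_geodesic \<Omega> \<phi> \<and>
           (\<forall>K. compact K \<and> K \<subseteq> ball 0 1 \<longrightarrow> uniform_limit K (\<lambda>k. \<phi>s (r k)) \<phi> sequentially)"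
proof -
  note \<Omega>s = assms(3)[THEN conjunct1] assms(3)[THEN conjunct2, THEN conjunct1]
    assms(3)[THEN conjunct2, THEN conjunct2]
  note conv = assms(7) and geod = assms(8)
  have holo: "holo_disc (\<phi>s n) (\<Omega>s n)" for n
    using geod[of n] by (simp add: complex_geodesic_def)
  have ab: "-1 < a n \<and> a n \<le> 0 \<and> 0 \<le> b n \<and> b n < 1" for n
    using assms(10,11)[of n] by auto
  have max: "bdist (\<Omega>s n) (\<phi>s n (of_real t)) \<le> bdist (\<Omega>s n) (\<phi>s n 0)" if "a n \<le> t" "t \<le> b n" for n t
    using assms(14)[of n] that by auto
  have \<phi>R: "norm (\<phi>s n (of_real t)) < R" if "a n \<le> t" "t \<le> b n" for n t
    using assms(12)[of n] that by (force simp: image_subset_iff)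
  have \<phi>0: "norm (\<phi>s n 0) < R" for n
    using \<phi>R[of n 0] assms(11)[of n] by simp
  obtain L where L: "0 < L" "(\<lambda>n. norm (\<phi>s n (of_real (a n)) - \<phi>s n (of_real (b n)))) \<longlonglongrightarrow> L"
    using assms(13) by blast
  obtain c where c: "0 < c" "\<forall>\<^sub>F n in sequentially. c \<le> bdist (\<Omega>s n) (\<phi>s n 0)"
    using eventually_bdist_centre_ge[OF assms(1,2) \<Omega>s assms(4) conv geod assms(9) ab \<phi>R L max] by blast
  obtain B where B: "\<forall>\<^sub>F n in sequentially. \<forall>p\<in>cball 0 R. bdist (\<Omega>s n) p \<le> B"
    using eventually_bdist_le_of_local_hausdorff_conv[OF conv assms(4-6)] by blast
  obtain N C where C: "0 < C" "\<And>n p v. N < n \<Longrightarrow> p \<in> \<Omega>s n \<inter> ball 0 R \<Longrightarrow> v \<noteq> 0 \<Longrightarrow>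
      bdist_dir (\<Omega>s n) p v \<le> C * bdist (\<Omega>s n) p powr (1 / m)"
    using assms(2,9) unfolding locally_m_convex_seq_def by meson
  \<comment> \<open>Montel's theorem asks for bounds on all members, so the sequence is later
    shifted by \<open>N0\<close>.\<close>
  obtain N0 where N0: "\<And>n. n \<ge> N0 \<Longrightarrow> c \<le> bdist (\<Omega>s n) (\<phi>s n 0) \<and> (\<forall>p\<in>cball 0 R. bdist (\<Omega>s n) p \<le> B) \<and> N < n"
    using eventually_conj[OF c(2) eventually_conj[OF B eventually_gt_at_top[of N]]]
    by (auto simp: eventually_sequentially)
  define M where "M = C * B powr (1 / m)"
  have M: "0 \<le> M"
    using C by (simp add: M_def)
  \<comment> \<open>This bound, uniform in the index and the direction, makes the discs locally
    bounded.\<close>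
  have dir: "bdist_dir (\<Omega>s n) (\<phi>s n 0) v \<le> M" if n: "n \<ge> N0" and v: "v \<noteq> 0" for n v
  proof -
    have "bdist_dir (\<Omega>s n) (\<phi>s n 0) v \<le> C * bdist (\<Omega>s n) (\<phi>s n 0) powr (1 / m)"
      using N0[OF n] \<phi>0[of n] holo[of n] v by (intro C(2)) (auto simp: holo_disc_def)
    also have "\<dots> \<le> M"
      unfolding M_def using N0[OF n] \<phi>0[of n] C(1) assms(1)
      by (intro mult_left_mono powr_mono2) (auto simp: bdist_def infdist_nonneg)
    finally show ?thesis .
  qed
  obtain g s where s: "strict_mono (s :: nat \<Rightarrow> nat)" and g: "\<And>i. (\<lambda>z. g z $ i) holomorphic_on ball 0 1"
    and lim: "\<And>K. compact K \<Longrightarrow> K \<subseteq> ball 0 1 \<Longrightarrow> uniform_limit K (\<lambda>n. \<phi>s (s n + N0)) g sequentially"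
  proof (rule Montel_vector[of "ball 0 1" "\<lambda>n. \<phi>s (n + N0)"])
    fix K :: "complex set" assume K: "compact K" "K \<subseteq> ball 0 1"
    \<comment> \<open>\<open>\<rho>\<close> bounds the pseudo-hyperbolic distance to 0 on
      \<open>K\<close>.\<close>
    obtain \<rho> where \<rho>: "0 \<le> \<rho>" "\<rho> < 1" "\<And>z. z \<in> K \<Longrightarrow> cmod z \<le> \<rho>"
    proof (cases "K = {}")
      case False
      then obtain w where "w \<in> K" "\<And>z. z \<in> K \<Longrightarrow> cmod z \<le> cmod w"
        using continuous_attains_sup[OF K(1), of cmod] continuous_on_norm_id by blast
      then show ?thesis
        using that[of "cmod w"] K(2) by auto
    qed (use that[of 0] in auto)
    have "norm (\<phi>s (n + N0) z) \<le> R + 2 * \<rho> / (1 - \<rho>) * M" if z: "z \<in> K" for n z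
    proof -
      have "norm (\<phi>s (n + N0) z - \<phi>s (n + N0) 0) \<le> 2 * \<rho> / (1 - \<rho>) * M"
        using \<rho>(2) \<rho>(3)[OF z] M dir[of "n + N0"] by (intro norm_diff_le_bdist_dir[OF \<Omega>s holo]) auto
      then show ?thesis
        using \<phi>0[of "n + N0"] norm_triangle_sub[of "\<phi>s (n + N0) z" "\<phi>s (n + N0) 0"] by linarith
    qed
    then show "\<exists>B. \<forall>n. \<forall>z\<in>K. norm (\<phi>s (n + N0) z) \<le> B"
      by blast
  qed (use holo in \<open>auto simp: holo_disc_def\<close>)
  define r where "r = (\<lambda>k. s k + N0)"
  have r: "strict_mono r"
    using s by (simp add: r_def strict_mono_def)
  have ptw: "(\<lambda>k. \<phi>s (r k) z) \<longlonglongrightarrow> g z" if "cmod z < 1" for z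
    using tendsto_uniform_limitI[OF lim[of "{z}"], of z] that by (simp add: r_def)
  \<comment> \<open>The lower bound at the centres passes to \<open>z\<close> with a positive factor
    independent of the index, so the limit avoids the boundary.\<close>
  have "g z \<in> \<Omega>" if z: "cmod z < 1" for z
  proof (rule local_hausdorff_conv_lim_in[OF conv assms(4,5) r ptw[OF z]])
    have "0 < 1 + cmod z"
      by (simp add: add_pos_nonneg)
    then show "0 < (1 - cmod z) / (1 + cmod z) * c"
      using z c by simp
    have "(1 - cmod z) / (1 + cmod z) * c \<le> bdist (\<Omega>s (r k)) (\<phi>s (r k) z)" for k
    proof -
      have "(1 - cmod z) / (1 + cmod z) * c \<le> (1 - cmod z) / (1 + cmod z) * bdist (\<Omega>s (r k)) (\<phi>s (r k) 0)"
        using N0[of "r k"] z \<open>0 < 1 + cmod z\<close> by (intro mult_left_mono) (auto simp: r_def)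
      also have "\<dots> \<le> bdist (\<Omega>s (r k)) (\<phi>s (r k) z)"
        by (rule bdist_holo_disc_ge[OF \<Omega>s holo z])
      finally show ?thesis .
    qed
    then show "\<forall>\<^sub>F k in sequentially. (1 - cmod z) / (1 + cmod z) * c \<le> bdist (\<Omega>s (r k)) (\<phi>s (r k) z)"
      by simp
  qed
  then have "holo_disc g \<Omega>"
    using g by (auto simp: holo_disc_def)
  then have "complex_geodesic \<Omega> g"
    using complex_geodesic_lim[OF conv \<Omega>s(1,2) assms(4) geod r] ptw by blast
  then show ?thesis
    using r lim by (intro exI[of _ r] exI[of _ g]) (simp add: r_def)
qed

end
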